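(* Let $\beta_+,\beta_-\in[0,\pi)$, put $\beta=(\beta_++\beta_-)/\pi\in[0,2)$ and $B=(\beta_+-\beta_-)/2$, and consider the massless spatial Dirac equation $\mathbb{D}\Phi=\omega\Phi$ on $[-\pi/2,\pi/2]$ with $\mathbb{D}=\begin{pmatrix}0&-\frac{d}{d\rho}\\ \frac{d}{d\rho}&0\end{pmatrix}$, $\omega\in\mathbb{R}$, $\Phi=(\Phi^{(1)},\Phi^{(2)})^T$, and boundary conditions $$\cos\beta_\pm\,\Phi^{(1)}(\pm\tfrac\pi2)=\mp\sin\beta_\pm\,\Phi^{(2)}(\pm\tfrac\pi2).$$ Then: (a) Non-zero solutions exist exactly for $\omega=\omega_j:=j+1-\beta$, $j\in\mathbb{Z}$; each is unique up to scalars, and the corresponding normalized modes are, for $m\in\mathbb{Z}$, $$\Psi_{2m}=\tfrac{1}{\sqrt\pi}\begin{pmatrix}\cos(\omega_{2m}\rho-B)\\-\sin(\omega_{2m}\rho-B)\end{pmatrix}e^{-i\omega_{2m}t},\qquad \Psi_{2m+1}=\tfrac1{\sqrt\pi}\begin{pmatrix}\sin(\omega_{2m+1}\rho-B)\\ \cos(\omega_{2m+1}\rho-B)\end{pmatrix}e^{-i\omega_{2m+1}t},$$ and $L_\pm\Psi_j=i(-1)^{j+1}\left(\frac12\pm\omega_j\right)\Psi_{j\pm1}$ for all $j\in\mathbb{Z}$. (b) If $\beta\ne\frac12,\frac32$, the span of $\{\Psi_j\}_{j\in\mathbb{Z}}$ is an irreducible unitary representation, namely the principal series $\mathscr{P}_0^\mu$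 with $\mu=-\beta$ if $0\le\beta<\frac12$, $\mu=1-\beta$ if $\frac12<\beta<\frac32$, and $\mu=2-\beta$ if $\frac32<\beta<2$. (c) If $\beta=\frac12$ or $\beta=\frac32$, the span of the positive-frequency modes and the span of the negative-frequency modes are each invariant, and they form the mock-discrete series representations $\mathscr{D}^+_{1/2}$ and $\mathscr{D}^-_{1/2}$, respectively. Moreover, in these cases, the normalized mode of each frequency $\omega\in\frac12+\mathbb{Z}$ equals, up to a sign, $R(\frac\pi2-\beta_+)$ times the normalized mode of the same frequency for $\beta_+=\frac\pi2,\ \beta_-=0$ (a chiral transformation), where $R(\theta)=\begin{pmatrix}\cos\theta&\sin\theta\\-\sin\theta&\cos\theta\end{pmatrix}$.
   Context: The boundary conditions are those defining the self-adjoint extension of $\mathbb{D}$ (initially defined on $C_c^\infty((-\pi/2,\pi/2),\mathbb{C}^2)$) labelled by the diagonal unitary matrix $U=\mathrm{diag}(e^{2i\beta_+},e^{2i\beta_-})$. The inner product is $\langle\Psi_1,\Psi_2\rangle=\int_{-\pi/2}^{\pi/2}\Psi_1(t,\rho)^\dagger\Psi_2(t,\rho)\,d\rho$. A mode has positive (negative) frequency if its time dependence is $e^{-i\omega t}$ with $\omega>0$ ($\omega<0$). The infinitesimal action of $\widetilde{\mathrm{SL}}(2,\mathbb{R})$ on spinors $\Psi(t,\rho)$ is $L_0=i\partial_t$ and $$L_\pm=e^{\mp it}\Big(\pm i\cos\rho\,\partial_\rho\mp\tfrac{i}{2}\sin\rho+\sin\rho\,\partial_t+\cos\rho\,\Sigma^{01}\Big),\qquad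 \Sigma^{01}=\tfrac12\begin{pmatrix}0&i\\-i&0\end{pmatrix},$$ with $[L_0,L_\pm]=\pm L_\pm$, $[L_+,L_-]=2L_0$, and Casimir $Q=L_0^2+\frac12(L_+L_-+L_-L_+)$. "Invariant" and "irreducible" refer to $L_0,L_+,L_-$. A space of modes forms a unitary representation (at the Lie algebra level) when it has an orthonormal basis of $L_0$-eigenvectors and $L_\pm^\dagger=-L_\mp$ on it. The irreducible unitary representations involved, all with $Q=-\frac14$, are: $\mathscr{P}^\mu_0$ ($|\mu|<\frac12$) with $L_0$-eigenvalues $\mu+k$, $k\in\mathbb{Z}$, each of multiplicity one; and $\mathscr{D}^\pm_{1/2}$ with $L_0$-eigenvalues $\pm(\frac12+n)$, $n\in\mathbb{N}\cup\{0\}$, each of multiplicity one. *)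

theory Defs
  imports "HOL-Analysis.Analysis" "HOL-Library.Function_Algebras"
begin

definition strip :: "real set" where
  "strip = {- pi / 2 .. pi / 2}"

text \<open>Derivatives at the endpoints of the interval are one-sided.\<close>

definition dirac :: "(real \<Rightarrow> complex^2) \<Rightarrow> real \<Rightarrow> complex^2" where
  "dirac \<Phi> \<rho> = vector
     [- vector_derivative (\<lambda>r. \<Phi> r $ 2) (at \<rho> within strip),
      vector_derivative (\<lambda>r. \<Phi> r $ 1) (at \<rho> within strip)]"

definition boundary_conditions :: "real \<Rightarrow> real \<Rightarrow> (real \<Rightarrow> complex^2) \<Rightarrow> bool" where
  "boundary_conditions \<beta>p \<beta>m \<Phi> \<longleftrightarrow>
     of_real (cos \<beta>p) * \<Phi> (pi / 2) $ 1 = - of_real (sin \<beta>p) * \<Phi> (pi / 2) $ 2 \<and>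
     of_real (cos \<beta>m) * \<Phi> (- pi / 2) $ 1 = of_real (sin \<beta>m) * \<Phi> (- pi / 2) $ 2"

definition dirac_solution :: "real \<Rightarrow> real \<Rightarrow> real \<Rightarrow> (real \<Rightarrow> complex^2) \<Rightarrow> bool" where
  "dirac_solution \<beta>p \<beta>m \<omega> \<Phi> \<longleftrightarrow>
     \<Phi> differentiable_on strip \<and>
     (\<forall>\<rho>\<in>strip. dirac \<Phi> \<rho> = \<omega> *\<^sub>R \<Phi> \<rho>) \<and>
     boundary_conditions \<beta>p \<beta>m \<Phi>"

text \<open>A field on \<open>\<real> \<times> [-\<pi>/2, \<pi>/2]\<close> is encoded as a function \<open>\<Psi> t \<rho>\<close> of two real arguments
  that vanishes for \<open>\<rho>\<close> outside the interval, so that equality of functions is equality of fields.\<close>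

type_synonym spinor_field = "real \<Rightarrow> real \<Rightarrow> complex^2"

definition spinor_fields :: "spinor_field set" where
  "spinor_fields = {\<Psi>. \<forall>t \<rho>. \<rho> \<notin> strip \<longrightarrow> \<Psi> t \<rho> = 0}"

definition fscale :: "complex \<Rightarrow> spinor_field \<Rightarrow> spinor_field" where
  "fscale c \<Psi> = (\<lambda>t \<rho>. c *s \<Psi> t \<rho>)"

global_interpretation cvs: vector_space fscale
  by unfold_locales
    (auto simp: fscale_def fun_eq_iff vec_eq_iff algebra_simps)

definition inner_at :: "real \<Rightarrow> spinor_field \<Rightarrow> spinor_field \<Rightarrow> complex" where
  "inner_at t \<Psi>1 \<Psi>2 = integral strip (\<lambda>\<rho>. \<Sum>a\<in>UNIV. cnj (\<Psi>1 t \<rho> $ a) * \<Psi>2 t \<rho> $ a)"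

definition normalized_mode :: "real \<Rightarrow> real \<Rightarrow> real \<Rightarrow> spinor_field \<Rightarrow> bool" where
  "normalized_mode \<beta>p \<beta>m \<omega> \<Psi> \<longleftrightarrow>
     \<Psi> \<in> spinor_fields \<and>
     (\<exists>\<Phi>. dirac_solution \<beta>p \<beta>m \<omega> \<Phi> \<and>
          (\<forall>t. \<forall>\<rho>\<in>strip. \<Psi> t \<rho> = exp (- \<i> * of_real (\<omega> * t)) *s \<Phi> \<rho>)) \<and>
     (\<forall>t. inner_at t \<Psi> \<Psi> = 1)"

definition freq :: "real \<Rightarrow> real \<Rightarrow> int \<Rightarrow> real" where
  "freq \<beta>p \<beta>m j = of_int j + 1 - (\<beta>p + \<beta>m) / pi"

definition mode :: "real \<Rightarrow> real \<Rightarrow> int \<Rightarrow> spinor_field" where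
  "mode \<beta>p \<beta>m j = (\<lambda>t \<rho>.
     let \<omega> = freq \<beta>p \<beta>m j; B = (\<beta>p - \<beta>m) / 2; x = \<omega> * \<rho> - B in
     if \<rho> \<in> strip then
       (of_real (1 / sqrt pi) * exp (- \<i> * of_real (\<omega> * t))) *s
         (if even j then vector [of_real (cos x), - of_real (sin x)]
          else vector [of_real (sin x), of_real (cos x)])
     else 0)"

definition chiral_rotation :: "real \<Rightarrow> complex^2^2" where
  "chiral_rotation \<theta> = vector
     [vector [of_real (cos \<theta>), of_real (sin \<theta>)],
      vector [- of_real (sin \<theta>), of_real (cos \<theta>)]]"

definition deriv_t :: "spinor_field \<Rightarrow> spinor_field" where
  "deriv_t \<Psi> = (\<lambda>t \<rho>. vector_derivative (\<lambda>s. \<Psi> s \<rho>) (at t))"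

definition deriv_rho :: "spinor_field \<Rightarrow> spinor_field" where
  "deriv_rho \<Psi> = (\<lambda>t \<rho>. vector_derivative (\<lambda>r. \<Psi> t r) (at \<rho> within strip))"

definition Sigma01 :: "complex^2^2" where
  "Sigma01 = vector [vector [0, \<i> / 2], vector [- \<i> / 2, 0]]"

definition L0 :: "spinor_field \<Rightarrow> spinor_field" where
  "L0 \<Psi> = (\<lambda>t \<rho>. if \<rho> \<in> strip then \<i> *s deriv_t \<Psi> t \<rho> else 0)"

text \<open>The sign \<open>\<sigma> = \<plusminus>1\<close> selects \<open>L\<^sub>+\<close> or \<open>L\<^sub>-\<close>.\<close>

definition ladder :: "real \<Rightarrow> spinor_field \<Rightarrow> spinor_field" where
  "ladder \<sigma> \<Psi> = (\<lambda>t \<rho>. if \<rho> \<in> strip then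
      exp (- \<i> * of_real (\<sigma> * t)) *s
        ((of_real \<sigma> * \<i> * of_real (cos \<rho>)) *s deriv_rho \<Psi> t \<rho>
         - (of_real \<sigma> * \<i> / 2 * of_real (sin \<rho>)) *s \<Psi> t \<rho>
         + of_real (sin \<rho>) *s deriv_t \<Psi> t \<rho>
         + of_real (cos \<rho>) *s (Sigma01 *v \<Psi> t \<rho>))
      else 0)"

abbreviation Lp :: "spinor_field \<Rightarrow> spinor_field" where "Lp \<equiv> ladder 1"
abbreviation Lm :: "spinor_field \<Rightarrow> spinor_field" where "Lm \<equiv> ladder (- 1)"

definition casimir :: "spinor_field \<Rightarrow> spinor_field" where
  "casimir \<Psi> = L0 (L0 \<Psi>) + fscale (1 / 2) (Lp (Lm \<Psi>) + Lm (Lp \<Psi>))"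

definition invariant :: "spinor_field set \<Rightarrow> bool" where
  "invariant V \<longleftrightarrow> (\<forall>\<Psi>\<in>V. L0 \<Psi> \<in> V \<and> Lp \<Psi> \<in> V \<and> Lm \<Psi> \<in> V)"

text \<open>Existence of the partial derivatives on all of \<open>V\<close> guarantees that the operators, which are
  defined through the total function \<open>vector_derivative\<close>, are genuine and linear on \<open>V\<close>.\<close>

definition representation :: "spinor_field set \<Rightarrow> bool" where
  "representation V \<longleftrightarrow>
     cvs.subspace V \<and> V \<subseteq> spinor_fields \<and>
     (\<forall>\<Psi>\<in>V. \<forall>t. \<forall>\<rho>\<in>strip. (\<lambda>s. \<Psi> s \<rho>) differentiable (at t) \<and>
                            (\<lambda>r. \<Psi> t r) differentiable (at \<rho> within strip)) \<and>
     invariant V \<and>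
     (\<forall>\<Psi>\<in>V. L0 (Lp \<Psi>) - Lp (L0 \<Psi>) = Lp \<Psi> \<and>
             L0 (Lm \<Psi>) - Lm (L0 \<Psi>) = - Lm \<Psi> \<and>
             Lp (Lm \<Psi>) - Lm (Lp \<Psi>) = fscale 2 (L0 \<Psi>))"

definition irreducible_rep :: "spinor_field set \<Rightarrow> bool" where
  "irreducible_rep V \<longleftrightarrow>
     representation V \<and> V \<noteq> {0} \<and>
     (\<forall>W. cvs.subspace W \<and> W \<subseteq> V \<and> invariant W \<longrightarrow> W = {0} \<or> W = V)"

text \<open>The inner product is taken at a fixed time; all conditions are imposed at every time.\<close>

definition unitary_rep :: "spinor_field set \<Rightarrow> bool" where
  "unitary_rep V \<longleftrightarrow>
     representation V \<and>
     (\<exists>E. cvs.span E = V \<and>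
          (\<forall>e\<in>E. \<exists>c. L0 e = fscale c e) \<and>
          (\<forall>t. \<forall>e\<in>E. \<forall>f\<in>E. inner_at t e f = (if e = f then 1 else 0))) \<and>
     (\<forall>t. \<forall>\<Psi>1\<in>V. \<forall>\<Psi>2\<in>V.
        inner_at t (Lp \<Psi>1) \<Psi>2 = - inner_at t \<Psi>1 (Lm \<Psi>2) \<and>
        inner_at t (Lm \<Psi>1) \<Psi>2 = - inner_at t \<Psi>1 (Lp \<Psi>2))"

definition L0_eigenspace :: "spinor_field set \<Rightarrow> complex \<Rightarrow> spinor_field set" where
  "L0_eigenspace V c = {\<Psi> \<in> V. L0 \<Psi> = fscale c \<Psi>}"

definition simple_L0_spectrum :: "spinor_field set \<Rightarrow> real set \<Rightarrow> bool" where
  "simple_L0_spectrum V S \<longleftrightarrow>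
     {c. L0_eigenspace V c \<noteq> {0}} = complex_of_real ` S \<and>
     (\<forall>s\<in>S. cvs.dim (L0_eigenspace V (of_real s)) = 1)"

definition principal_series :: "real \<Rightarrow> spinor_field set \<Rightarrow> bool" where
  "principal_series \<mu> V \<longleftrightarrow>
     \<bar>\<mu>\<bar> < 1 / 2 \<and> irreducible_rep V \<and> unitary_rep V \<and>
     (\<forall>\<Psi>\<in>V. casimir \<Psi> = fscale (- 1 / 4) \<Psi>) \<and>
     simple_L0_spectrum V (range (\<lambda>k::int. \<mu> + of_int k))"

text \<open>The mock-discrete series; the sign \<open>\<sigma> = \<plusminus>1\<close> selects the one with positive or negative
  \<open>L\<^sub>0\<close>-eigenvalues.\<close>

definition mock_discrete_series :: "real \<Rightarrow> spinor_field set \<Rightarrow> bool" where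
  "mock_discrete_series \<sigma> V \<longleftrightarrow>
     irreducible_rep V \<and> unitary_rep V \<and>
     (\<forall>\<Psi>\<in>V. casimir \<Psi> = fscale (- 1 / 4) \<Psi>) \<and>
     simple_L0_spectrum V (range (\<lambda>n::nat. \<sigma> * (1 / 2 + of_nat n)))"

end

theory Submission
  imports Defs
begin

text \<open>With \<open>spinor y = (cos y, - sin y)\<close>, all modes are plane waves
  \<open>exp (- \<i> \<omega> t) spinor (\<omega> \<rho> + \<phi>)\<close>, the odd ones having their phase shifted by \<open>- \<pi>/2\<close> because
  \<open>(sin y, cos y) = spinor (y - \<pi>/2)\<close>. Rotating a solution of the Dirac equation back by the angle
  \<open>\<omega> \<rho> - B\<close> makes it constant, say \<open>(u, v)\<close>, and in these coordinates the boundary conditions read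
  \<open>u cos p = v sin p = 0\<close> with \<open>p = (\<omega> + \<beta>) \<pi>/2\<close>, which gives the spectrum. The operators \<open>L\<^sub>\<plusminus>\<close> send
  a plane wave to a plane wave, shifting \<open>\<omega>\<close> by \<open>\<plusminus> 1\<close> and \<open>\<phi>\<close> by \<open>- \<pi>/2\<close>, so that the ladder of modes
  is broken only between the frequencies \<open>- 1/2\<close> and \<open>1/2\<close>. As \<open>L\<^sub>0\<close> has simple spectrum on the
  modes, an invariant subspace contains every mode occurring in one of its elements, hence the whole
  unbroken part of the ladder.\<close>

section \<open>Plane waves and the Dirac equation\<close>

lemma vec2_eq_iff: "(x :: 'a^2) = y \<longleftrightarrow> x $ 1 = y $ 1 \<and> x $ 2 = y $ 2"
  by (simp add: vec_eq_iff forall_2)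

text \<open>Real-linear maps on a finite-dimensional space are bounded. Boundedness is what lets
  vector derivatives pass through the complex scaling \<open>*s\<close>.\<close>

lemma bounded_linear_vector_scale_left: "bounded_linear (\<lambda>c::complex. c *s (v :: complex^2))"
  by (rule linear_conv_bounded_linear[THEN iffD1], rule linearI)
    (simp_all add: vec_eq_iff algebra_simps)

lemma has_vector_derivative_vec2:
  fixes f :: "real \<Rightarrow> complex^2"
  assumes "((\<lambda>x. f x $ 1) has_vector_derivative f' $ 1) F"
    and "((\<lambda>x. f x $ 2) has_vector_derivative f' $ 2) F"
  shows "(f has_vector_derivative f') F"
proof -
  have eq: "y = y $ 1 *s axis (1::2) 1 + y $ 2 *s axis (2::2) 1" for y :: "complex^2"
    by (simp add: vec2_eq_iff axis_def)
  have "((\<lambda>x. f x $ 1 *s axis (1::2) 1 + f x $ 2 *s axis (2::2) 1) has_vector_derivative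
      f' $ 1 *s axis (1::2) 1 + f' $ 2 *s axis (2::2) 1) F"
    by (intro has_vector_derivative_add bounded_linear.has_vector_derivative[OF bounded_linear_vector_scale_left] assms)
  then show ?thesis
    by (simp flip: eq)
qed

text \<open>A non-degenerate interval has no isolated points, so derivatives within it are unique
  even at the two endpoints.\<close>

lemma strip_nontrivial: "\<rho> \<in> strip \<Longrightarrow> at \<rho> within strip \<noteq> bot"
  by (simp add: strip_def trivial_limit_within islimpt_Icc)

lemma vector_derivative_strip:
  fixes f :: "real \<Rightarrow> 'a::real_normed_vector"
  assumes "\<rho> \<in> strip" and "(f has_vector_derivative f') (at \<rho> within strip)"
  shows "vector_derivative f (at \<rho> within strip) = f'"
  using assms by (intro vector_derivative_within strip_nontrivial)

text \<open>This is the matrix \<open>chiral_rotation y\<close> applied to the first basis vector,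
  so a further rotation only adds to \<open>y\<close>.\<close>

definition spinor :: "real \<Rightarrow> complex^2" where
  "spinor y = vector [of_real (cos y), - of_real (sin y)]"

lemma spinor_nth [simp]: "spinor y $ 1 = of_real (cos y)" "spinor y $ 2 = - of_real (sin y)"
  by (simp_all add: spinor_def)

lemma spinor_shift_nth [simp]:
  "spinor (y - pi / 2) $ 1 = of_real (sin y)" "spinor (y - pi / 2) $ 2 = of_real (cos y)"
  by (simp_all add: cos_diff sin_diff)

lemma spinor_minus_pi: "spinor (y - pi) = - spinor y"
  by (simp add: vec2_eq_iff)

lemma has_vector_derivative_cos_phase:
  "((\<lambda>r. complex_of_real (cos (\<omega> * r + \<phi>))) has_vector_derivative
     - (of_real \<omega> * of_real (sin (\<omega> * r + \<phi>)))) (at r within S)"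
proof -
  have "((\<lambda>r. cos (\<omega> * r + \<phi>)) has_real_derivative - (\<omega> * sin (\<omega> * r + \<phi>))) (at r within S)"
    by (auto intro!: derivative_eq_intros)
  from has_vector_derivative_of_real[OF this] show ?thesis
    by simp
qed

lemma has_vector_derivative_sin_phase:
  "((\<lambda>r. complex_of_real (sin (\<omega> * r + \<phi>))) has_vector_derivative
     of_real \<omega> * of_real (cos (\<omega> * r + \<phi>))) (at r within S)"
proof -
  have "((\<lambda>r. sin (\<omega> * r + \<phi>)) has_real_derivative \<omega> * cos (\<omega> * r + \<phi>)) (at r within S)"
    by (auto intro!: derivative_eq_intros)
  from has_vector_derivative_of_real[OF this] show ?thesis
    by simp
qed

text \<open>The velocity of a rotating unit vector is a quarter turn of the vector itself, so
  differentiation stays within the family of spinors.\<close>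

lemma has_vector_derivative_spinor:
  "((\<lambda>r. c *s spinor (\<omega> * r + \<phi>)) has_vector_derivative
     (c * - of_real \<omega>) *s spinor (\<omega> * r + \<phi> - pi / 2)) (at r within S)"
  using has_vector_derivative_cos_phase[of \<omega> \<phi> r S, THEN has_vector_derivative_mult_right, of c]
    has_vector_derivative_sin_phase[of \<omega> \<phi> r S, THEN has_vector_derivative_mult_right, of "- c"]
  by (intro has_vector_derivative_vec2) (simp_all add: sin_diff cos_diff algebra_simps)

text \<open>The two spinors form an orthonormal frame of solutions, so the coordinates of any
  solution in this frame have zero derivative and are constant on the convex strip. The phase
  \<open>\<phi>\<close> is left free here; \<open>dirac_solution_iff\<close> chooses it to suit the
  boundary conditions.\<close>

lemma dirac_solution_general:
  assumes "\<Phi> differentiable_on strip" and "\<And>\<rho>. \<rho> \<in> strip \<Longrightarrow> dirac \<Phi> \<rho> = \<omega> *\<^sub>R \<Phi> \<rho>"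
  obtains u v where "\<And>\<rho>. \<rho> \<in> strip \<Longrightarrow>
    \<Phi> \<rho> = u *s spinor (\<omega> * \<rho> + \<phi>) + v *s spinor (\<omega> * \<rho> + \<phi> - pi / 2)"
proof -
  \<comment> \<open>The Dirac equation only prescribes values of \<open>vector_derivative\<close>;
    differentiability of \<open>\<Phi>\<close> turns them into genuine derivatives of the
    components.\<close>
  have d: "((\<lambda>r. \<Phi> r $ 1) has_vector_derivative \<omega> * \<Phi> \<rho> $ 2) (at \<rho> within strip)"
    "((\<lambda>r. \<Phi> r $ 2) has_vector_derivative - (\<omega> * \<Phi> \<rho> $ 1)) (at \<rho> within strip)"
    if \<rho>: "\<rho> \<in> strip" for \<rho>
  proof -
    define D' where "D' = vector_derivative \<Phi> (at \<rho> within strip)"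
    have D': "(\<Phi> has_vector_derivative D') (at \<rho> within strip)"
      using assms(1) \<rho> unfolding differentiable_on_def D'_def vector_derivative_works by simp
    have nth: "((\<lambda>r. \<Phi> r $ i) has_vector_derivative D' $ i) (at \<rho> within strip)" for i
      by (rule bounded_linear.has_vector_derivative[OF bounded_linear_vec_nth D'])
    have "vector_derivative (\<lambda>r. \<Phi> r $ i) (at \<rho> within strip) = D' $ i" for i
      by (rule vector_derivative_strip[OF \<rho> nth])
    then have D1: "\<omega> * \<Phi> \<rho> $ 2 = D' $ 1" and "\<omega> * \<Phi> \<rho> $ 1 = - D' $ 2"
      using assms(2)[OF \<rho>]
      by (simp_all add: dirac_def vec2_eq_iff scaleR_conv_of_real[where 'a = complex])
    then have D2: "- (\<omega> * \<Phi> \<rho> $ 1) = D' $ 2"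
      by simp
    show "((\<lambda>r. \<Phi> r $ 1) has_vector_derivative \<omega> * \<Phi> \<rho> $ 2) (at \<rho> within strip)"
      "((\<lambda>r. \<Phi> r $ 2) has_vector_derivative - (\<omega> * \<Phi> \<rho> $ 1)) (at \<rho> within strip)"
      unfolding D1 D2 by (rule nth)+
  qed
  let ?c = "\<lambda>r. complex_of_real (cos (\<omega> * r + \<phi>))" and ?s = "\<lambda>r. complex_of_real (sin (\<omega> * r + \<phi>))"
  have dc: "(?c has_vector_derivative - (\<omega> * ?s r)) (at r within strip)"
    and ds: "(?s has_vector_derivative \<omega> * ?c r) (at r within strip)" for r
    using has_vector_derivative_cos_phase has_vector_derivative_sin_phase by auto
  have conv: "convex strip"
    by (simp add: strip_def)
  \<comment> \<open>The coordinates in the rotating frame are obtained by applying the inverse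
    rotation; the four terms of the product rule cancel in pairs.\<close>
  have "((\<lambda>r. ?c r * \<Phi> r $ 1 - ?s r * \<Phi> r $ 2) has_vector_derivative 0) (at r within strip)"
    if "r \<in> strip" for r
    by (rule has_vector_derivative_diff[OF has_vector_derivative_mult[OF dc d(1)[OF that]]
          has_vector_derivative_mult[OF ds d(2)[OF that]], THEN has_vector_derivative_eq_rhs])
      (simp add: algebra_simps)
  from has_vector_derivative_zero_constant[OF conv this] obtain u where
    u: "\<And>r. r \<in> strip \<Longrightarrow> ?c r * \<Phi> r $ 1 - ?s r * \<Phi> r $ 2 = u"
    by blast
  have "((\<lambda>r. ?s r * \<Phi> r $ 1 + ?c r * \<Phi> r $ 2) has_vector_derivative 0) (at r within strip)"
    if "r \<in> strip" for r
    by (rule has_vector_derivative_add[OF has_vector_derivative_mult[OF ds d(1)[OF that]]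
          has_vector_derivative_mult[OF dc d(2)[OF that]], THEN has_vector_derivative_eq_rhs])
      (simp add: algebra_simps)
  from has_vector_derivative_zero_constant[OF conv this] obtain v where
    v: "\<And>r. r \<in> strip \<Longrightarrow> ?s r * \<Phi> r $ 1 + ?c r * \<Phi> r $ 2 = v"
    by blast
  show ?thesis
  proof
    fix r assume r: "r \<in> strip"
    have *: "?c r * ?c r + ?s r * ?s r = 1"
      by (metis of_real_1 of_real_add of_real_mult power2_eq_square sin_cos_squared_add2)
    show "\<Phi> r = u *s spinor (\<omega> * r + \<phi>) + v *s spinor (\<omega> * r + \<phi> - pi / 2)"
    proof -
      have "(a * x - b * y) * a + (b * x + a * y) * b = (a * a + b * b) * x"
        "- (a * x - b * y) * b + (b * x + a * y) * a = (a * a + b * b) * y" for a b x y :: complex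
        by (simp_all add: algebra_simps)
      then have "\<Phi> r $ 1 = u * ?c r + v * ?s r" "\<Phi> r $ 2 = - u * ?s r + v * ?c r"
        unfolding u[OF r, symmetric] v[OF r, symmetric] by (simp_all only: * mult_1_left)
      then show ?thesis
        by (simp add: vec2_eq_iff cos_diff sin_diff)
    qed
  qed
qed

section \<open>Plane waves and the action of the operators on them\<close>

definition wave :: "real \<Rightarrow> real \<Rightarrow> spinor_field" where
  "wave \<omega> \<phi> = (\<lambda>t \<rho>. if \<rho> \<in> strip
     then (of_real (1 / sqrt pi) * exp (- \<i> * of_real (\<omega> * t))) *s spinor (\<omega> * \<rho> + \<phi>) else 0)"

lemma has_vector_derivative_wave_t:
  assumes "\<rho> \<in> strip"
  shows "((\<lambda>s. wave \<omega> \<phi> s \<rho>) has_vector_derivative (- \<i> * of_real \<omega>) *s wave \<omega> \<phi> t \<rho>) (at t)"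
proof -
  have "((\<lambda>s. exp (- \<i> * (of_real \<omega> * of_real s))) has_vector_derivative
      (- \<i> * of_real \<omega>) * exp (- \<i> * (of_real \<omega> * of_real t))) (at t)"
    by (rule has_vector_derivative_real_field[where f = "\<lambda>z. exp (- \<i> * (of_real \<omega> * z))"])
      (auto intro!: derivative_eq_intros)
  from bounded_linear.has_vector_derivative[OF bounded_linear_vector_scale_left
      has_vector_derivative_mult_right[OF this, of "of_real (1 / sqrt pi)"], of "spinor (\<omega> * \<rho> + \<phi>)"]
  show ?thesis
    using assms unfolding wave_def by (simp only: if_True of_real_mult vector_smult_assoc mult_ac)
qed

lemma has_vector_derivative_wave_rho:
  assumes "\<rho> \<in> strip"
  shows "((\<lambda>r. wave \<omega> \<phi> t r) has_vector_derivative
     (of_real (1 / sqrt pi) * exp (- \<i> * of_real (\<omega> * t)) * - of_real \<omega>) *s spinor (\<omega> * \<rho> + \<phi> - pi / 2))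
     (at \<rho> within strip)"
  by (rule has_vector_derivative_transform[OF assms _ has_vector_derivative_spinor])
    (simp add: wave_def)

lemma L0_wave: "L0 (wave \<omega> \<phi>) = fscale (of_real \<omega>) (wave \<omega> \<phi>)"
proof (intro ext)
  fix t \<rho>
  show "L0 (wave \<omega> \<phi>) t \<rho> = fscale (of_real \<omega>) (wave \<omega> \<phi>) t \<rho>"
  proof (cases "\<rho> \<in> strip")
    case True
    then show ?thesis
      unfolding L0_def deriv_t_def fscale_def vector_derivative_at[OF has_vector_derivative_wave_t[OF True]]
      by (simp add: vec_eq_iff)
  next
    case False
    then show ?thesis
      by (simp add: L0_def fscale_def wave_def)
  qed
qed

text \<open>With \<open>y = \<omega> * \<rho> + \<phi>\<close>, the matrix \<open>Sigma01\<close>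
  sends \<open>spinor y\<close> to \<open>- \<i> / 2\<close> times
  \<open>spinor (y - pi / 2)\<close>, the direction of the derivative along \<rho>. As \<sigma>
  squares to one, the terms with \<open>cos \<rho>\<close> and with \<open>sin \<rho>\<close> share
  the factor \<open>1 / 2 + \<sigma> * \<omega>\<close>, and the addition theorems merge them into
  one spinor whose angle has advanced by \<open>\<sigma> * \<rho>\<close>.\<close>

lemma ladder_wave:
  assumes "\<sigma> = 1 \<or> \<sigma> = - 1"
  shows "ladder \<sigma> (wave \<omega> \<phi>) = fscale (- \<i> * of_real (1 / 2 + \<sigma> * \<omega>)) (wave (\<omega> + \<sigma>) (\<phi> - pi / 2))"
proof (intro ext)
  fix t \<rho>
  show "ladder \<sigma> (wave \<omega> \<phi>) t \<rho> = fscale (- \<i> * of_real (1 / 2 + \<sigma> * \<omega>)) (wave (\<omega> + \<sigma>) (\<phi> - pi / 2)) t \<rho>"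
  proof (cases "\<rho> \<in> strip")
    case True
    have e: "exp (- \<i> * of_real (\<sigma> * t)) * exp (- \<i> * of_real (\<omega> * t)) = exp (- \<i> * of_real ((\<omega> + \<sigma>) * t))"
      by (simp flip: exp_add add: algebra_simps)
    define y where "y = \<omega> * \<rho> + \<phi>"
    have y: "(\<omega> + \<sigma>) * \<rho> + (\<phi> - pi / 2) = (y + \<sigma> * \<rho>) - pi / 2"
      by (simp add: y_def algebra_simps)
    \<comment> \<open>Naming the scalar factors keeps them opaque to the simplifier, so that only a
      trigonometric identity in \<open>y\<close> and \<open>\<rho>\<close> remains.\<close>
    define k where "k = complex_of_real (1 / sqrt pi)"
    define E where "E = exp (- \<i> * of_real (\<omega> * t))"
    define E' where "E' = exp (- \<i> * of_real (\<sigma> * t))"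
    show ?thesis
      using assms True
      apply (simp only: ladder_def deriv_t_def deriv_rho_def vector_derivative_at[OF has_vector_derivative_wave_t]
          vector_derivative_strip[OF _ has_vector_derivative_wave_rho] fscale_def if_True)
      apply (simp only: wave_def if_True y e[symmetric] y_def[symmetric] E_def[symmetric] E'_def[symmetric] k_def[symmetric])
      apply (auto simp: vec2_eq_iff Sigma01_def matrix_vector_mult_def sum_2 sin_add cos_add sin_diff cos_diff)
      apply (simp_all add: algebra_simps)
      done
  next
    case False
    then show ?thesis
      by (simp add: ladder_def wave_def fscale_def)
  qed
qed

section \<open>Differentiable fields and the inner product\<close>

lemma bounded_linear_vector_scale: "bounded_linear (\<lambda>v :: complex^2. c *s v)"
  by (rule linear_conv_bounded_linear[THEN iffD1], rule linearI)
    (simp_all add: vec_eq_iff algebra_simps)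

lemma fscale_apply: "fscale c \<Psi> t \<rho> = c *s \<Psi> t \<rho>"
  by (simp add: fscale_def)

text \<open>A common domain of linearity for the operators: the total function
  \<open>vector_derivative\<close> is certain to respect sums only where the derivatives
  exist.\<close>

definition differentiable_fields :: "spinor_field set" where
  "differentiable_fields = {\<Psi> \<in> spinor_fields. \<forall>t. \<forall>\<rho>\<in>strip.
     (\<lambda>s. \<Psi> s \<rho>) differentiable (at t) \<and> (\<lambda>r. \<Psi> t r) differentiable (at \<rho> within strip)}"

lemma differentiable_fieldsD:
  assumes "\<Psi> \<in> differentiable_fields" and "\<rho> \<in> strip"
  shows "((\<lambda>s. \<Psi> s \<rho>) has_vector_derivative deriv_t \<Psi> t \<rho>) (at t)"
    and "((\<lambda>r. \<Psi> t r) has_vector_derivative deriv_rho \<Psi> t \<rho>) (at \<rho> within strip)"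
  using assms by (auto simp: differentiable_fields_def deriv_t_def deriv_rho_def vector_derivative_works)

lemma fscale_add_has_vector_derivative:
  assumes "\<Psi>1 \<in> differentiable_fields" and "\<Psi>2 \<in> differentiable_fields" and "\<rho> \<in> strip"
  shows "((\<lambda>s. (fscale c \<Psi>1 + \<Psi>2) s \<rho>) has_vector_derivative c *s deriv_t \<Psi>1 t \<rho> + deriv_t \<Psi>2 t \<rho>) (at t)"
    and "((\<lambda>r. (fscale c \<Psi>1 + \<Psi>2) t r) has_vector_derivative c *s deriv_rho \<Psi>1 t \<rho> + deriv_rho \<Psi>2 t \<rho>)
      (at \<rho> within strip)"
  unfolding fscale_def plus_fun_def
  by (intro has_vector_derivative_add bounded_linear.has_vector_derivative[OF bounded_linear_vector_scale]
      differentiable_fieldsD assms)+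

lemma deriv_t_fscale_add:
  assumes "\<Psi>1 \<in> differentiable_fields" and "\<Psi>2 \<in> differentiable_fields" and "\<rho> \<in> strip"
  shows "deriv_t (fscale c \<Psi>1 + \<Psi>2) t \<rho> = c *s deriv_t \<Psi>1 t \<rho> + deriv_t \<Psi>2 t \<rho>"
  unfolding deriv_t_def[of "fscale c \<Psi>1 + \<Psi>2"]
  by (rule vector_derivative_at[OF fscale_add_has_vector_derivative(1)[OF assms]])

lemma deriv_rho_fscale_add:
  assumes "\<Psi>1 \<in> differentiable_fields" and "\<Psi>2 \<in> differentiable_fields" and "\<rho> \<in> strip"
  shows "deriv_rho (fscale c \<Psi>1 + \<Psi>2) t \<rho> = c *s deriv_rho \<Psi>1 t \<rho> + deriv_rho \<Psi>2 t \<rho>"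
  unfolding deriv_rho_def[of "fscale c \<Psi>1 + \<Psi>2"]
  by (rule vector_derivative_strip[OF assms(3) fscale_add_has_vector_derivative(2)[OF assms]])

lemma differentiable_fields_fscale_add:
  assumes "\<Psi>1 \<in> differentiable_fields" and "\<Psi>2 \<in> differentiable_fields"
  shows "fscale c \<Psi>1 + \<Psi>2 \<in> differentiable_fields"
proof -
  have "fscale c \<Psi>1 + \<Psi>2 \<in> spinor_fields"
    using assms by (auto simp: differentiable_fields_def spinor_fields_def fscale_def)
  then show ?thesis
    using fscale_add_has_vector_derivative[OF assms, THEN differentiableI_vector]
    unfolding differentiable_fields_def by blast
qed

lemma zero_differentiable_fields: "0 \<in> differentiable_fields"
  by (simp add: differentiable_fields_def spinor_fields_def zero_fun_def)

lemma subspace_differentiable_fields: "cvs.subspace differentiable_fields"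
proof (rule cvs.subspaceI)
  show "x + y \<in> differentiable_fields" if "x \<in> differentiable_fields" "y \<in> differentiable_fields" for x y
    using differentiable_fields_fscale_add[OF that, of 1] by simp
  show "fscale c x \<in> differentiable_fields" if "x \<in> differentiable_fields" for c x
    using differentiable_fields_fscale_add[OF that zero_differentiable_fields, of c] by simp
qed (rule zero_differentiable_fields)

text \<open>Linearity is relative to a set because the operators are handled as linear maps only on
  differentiable fields. The single identity covers sums (\<open>c = 1\<close>) and, once
  \<open>0 \<in> V\<close>, multiples.\<close>

definition linear_on_fields :: "spinor_field set \<Rightarrow> (spinor_field \<Rightarrow> spinor_field) \<Rightarrow> bool" where
  "linear_on_fields V T \<longleftrightarrow>
     (\<forall>c. \<forall>\<Psi>1\<in>V. \<forall>\<Psi>2\<in>V. T (fscale c \<Psi>1 + \<Psi>2) = fscale c (T \<Psi>1) + T \<Psi>2)"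

lemma linear_on_fields_L0: "linear_on_fields differentiable_fields L0"
  unfolding linear_on_fields_def
proof (intro allI ballI ext)
  fix c \<Psi>1 \<Psi>2 t \<rho>
  assume *: "\<Psi>1 \<in> differentiable_fields" "\<Psi>2 \<in> differentiable_fields"
  show "L0 (fscale c \<Psi>1 + \<Psi>2) t \<rho> = (fscale c (L0 \<Psi>1) + L0 \<Psi>2) t \<rho>"
    by (cases "\<rho> \<in> strip")
      (simp_all only: L0_def plus_fun_apply fscale_apply deriv_t_fscale_add[OF *],
        simp_all add: vec_eq_iff algebra_simps)
qed

lemma linear_on_fields_ladder: "linear_on_fields differentiable_fields (ladder \<sigma>)"
  unfolding linear_on_fields_def
proof (intro allI ballI ext)
  fix c \<Psi>1 \<Psi>2 t \<rho>
  assume *: "\<Psi>1 \<in> differentiable_fields" "\<Psi>2 \<in> differentiable_fields"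
  show "ladder \<sigma> (fscale c \<Psi>1 + \<Psi>2) t \<rho> = (fscale c (ladder \<sigma> \<Psi>1) + ladder \<sigma> \<Psi>2) t \<rho>"
  proof (cases "\<rho> \<in> strip")
    case True
    then show ?thesis
      by (simp only: ladder_def plus_fun_apply fscale_apply deriv_t_fscale_add[OF * True]
          deriv_rho_fscale_add[OF * True] if_True)
        (simp add: vec2_eq_iff matrix_vector_mult_def sum_2 algebra_simps)
  next
    case False
    then show ?thesis
      by (simp add: ladder_def fscale_def)
  qed
qed

section \<open>Sesquilinearity of the inner product and inner products of plane waves\<close>

lemma inner_at_integrable:
  assumes "\<Psi>1 \<in> differentiable_fields" and "\<Psi>2 \<in> differentiable_fields"
  shows "(\<lambda>\<rho>. \<Sum>a\<in>UNIV. cnj (\<Psi>1 t \<rho> $ a) * \<Psi>2 t \<rho> $ a) integrable_on strip"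
proof -
  \<comment> \<open>Differentiability along the compact strip gives continuity, hence integrability,
    without which \<open>integral\<close> could not be split over sums.\<close>
  have "continuous_on strip (\<Psi> t)" if "\<Psi> \<in> differentiable_fields" for \<Psi> :: spinor_field
    using that by (intro differentiable_imp_continuous_on)
      (auto simp: differentiable_on_def differentiable_fields_def)
  with assms have "continuous_on strip (\<lambda>\<rho>. \<Sum>a\<in>UNIV. cnj (\<Psi>1 t \<rho> $ a) * \<Psi>2 t \<rho> $ a)"
    by (intro continuous_intros) auto
  then show ?thesis
    unfolding strip_def by (rule integrable_continuous_interval)
qed

lemma inner_at_fscale_add_right:
  assumes "\<Psi> \<in> differentiable_fields" "\<Psi>1 \<in> differentiable_fields" and "\<Psi>2 \<in> differentiable_fields"
  shows "inner_at t \<Psi> (fscale c \<Psi>1 + \<Psi>2) = c * inner_at t \<Psi> \<Psi>1 + inner_at t \<Psi> \<Psi>2"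
proof -
  note int = inner_at_integrable[OF assms(1,2)] inner_at_integrable[OF assms(1,3)]
  have "inner_at t \<Psi> (fscale c \<Psi>1 + \<Psi>2) = integral strip (\<lambda>\<rho>. c * (\<Sum>a\<in>UNIV. cnj (\<Psi> t \<rho> $ a) * \<Psi>1 t \<rho> $ a)
      + (\<Sum>a\<in>UNIV. cnj (\<Psi> t \<rho> $ a) * \<Psi>2 t \<rho> $ a))"
    unfolding inner_at_def by (simp add: fscale_def sum_2 algebra_simps)
  also have "\<dots> = c * inner_at t \<Psi> \<Psi>1 + inner_at t \<Psi> \<Psi>2"
    unfolding inner_at_def using int
    by (simp add: integral_add integrable_on_mult_right integral_mult_right)
  finally show ?thesis .
qed

lemma cnj_inner_at: "cnj (inner_at t \<Psi>1 \<Psi>2) = inner_at t \<Psi>2 \<Psi>1"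
  by (simp add: inner_at_def integral_cnj mult.commute)

lemma inner_at_fscale_add_left:
  assumes "\<Psi> \<in> differentiable_fields" "\<Psi>1 \<in> differentiable_fields" and "\<Psi>2 \<in> differentiable_fields"
  shows "inner_at t (fscale c \<Psi>1 + \<Psi>2) \<Psi> = cnj c * inner_at t \<Psi>1 \<Psi> + inner_at t \<Psi>2 \<Psi>"
  using inner_at_fscale_add_right[OF assms, of t c] cnj_inner_at
  by (metis complex_cnj_add complex_cnj_mult)

lemma inner_at_zero [simp]: "inner_at t 0 \<Psi> = 0" "inner_at t \<Psi> 0 = 0"
  by (simp_all add: inner_at_def)

lemma wave_differentiable_fields: "wave \<omega> \<phi> \<in> differentiable_fields"
proof -
  have "wave \<omega> \<phi> \<in> spinor_fields"
    by (simp add: spinor_fields_def wave_def)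
  then show ?thesis
    using has_vector_derivative_wave_t[THEN differentiableI_vector]
      has_vector_derivative_wave_rho[THEN differentiableI_vector]
    unfolding differentiable_fields_def by blast
qed

text \<open>The pointwise product of two spinors is the cosine of their angle difference, and the
  two time factors combine into a phase that leaves the integral.\<close>

lemma inner_at_wave:
  "inner_at t (wave \<omega> \<phi>) (wave \<omega>' \<phi>') =
     exp (\<i> * of_real ((\<omega> - \<omega>') * t)) / of_real pi *
     integral strip (\<lambda>\<rho>. of_real (cos ((\<omega> - \<omega>') * \<rho> + (\<phi> - \<phi>'))))"
proof -
  have e: "exp (\<i> * of_real ((\<omega> - \<omega>') * t)) = exp (\<i> * of_real (\<omega> * t)) * exp (- \<i> * of_real (\<omega>' * t))"
    by (simp flip: exp_add add: algebra_simps)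
  have s: "complex_of_real (sqrt pi) * complex_of_real (sqrt pi) = of_real pi"
    by (simp flip: of_real_mult)
  have "(\<Sum>a\<in>UNIV. cnj (wave \<omega> \<phi> t \<rho> $ a) * wave \<omega>' \<phi>' t \<rho> $ a) =
      exp (\<i> * of_real ((\<omega> - \<omega>') * t)) / of_real pi * of_real (cos ((\<omega> - \<omega>') * \<rho> + (\<phi> - \<phi>')))"
    if "\<rho> \<in> strip" for \<rho>
  proof -
    have "(\<omega> - \<omega>') * \<rho> + (\<phi> - \<phi>') = (\<omega> * \<rho> + \<phi>) - (\<omega>' * \<rho> + \<phi>')"
      by (simp add: algebra_simps)
    then have c: "complex_of_real (cos ((\<omega> - \<omega>') * \<rho> + (\<phi> - \<phi>'))) =
        of_real (cos (\<omega> * \<rho> + \<phi>)) * of_real (cos (\<omega>' * \<rho> + \<phi>')) +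
        of_real (sin (\<omega> * \<rho> + \<phi>)) * of_real (sin (\<omega>' * \<rho> + \<phi>'))"
      by (simp only: cos_diff of_real_add of_real_mult)
    show ?thesis
      using that unfolding e c s[symmetric]
      by (simp add: wave_def sum_2 exp_cnj divide_simps algebra_simps)
  qed
  then show ?thesis
    unfolding inner_at_def by (simp cong: integral_cong add: integral_mult_right)
qed

lemma integral_cos_strip:
  assumes "n \<noteq> 0"
  shows "integral strip (\<lambda>\<rho>. complex_of_real (cos (n * \<rho> + \<delta>))) = of_real (2 * cos \<delta> * sin (n * pi / 2) / n)"
proof -
  have "((\<lambda>\<rho>. cos (n * \<rho> + \<delta>)) has_integral sin (n * (pi / 2) + \<delta>) / n - sin (n * (- pi / 2) + \<delta>) / n) {- pi / 2 .. pi / 2}"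
    using assms by (intro fundamental_theorem_of_calculus)
      (auto intro!: derivative_eq_intros simp flip: has_real_derivative_iff_has_vector_derivative)
  also have "sin (n * (pi / 2) + \<delta>) / n - sin (n * (- pi / 2) + \<delta>) / n = 2 * cos \<delta> * sin (n * pi / 2) / n"
  proof -
    define y where "y = n * pi / 2"
    have "n * (pi / 2) + \<delta> = y + \<delta>" "n * (- pi / 2) + \<delta> = \<delta> - y"
      by (simp_all add: y_def)
    then show ?thesis
      by (simp only: sin_add sin_diff y_def[symmetric]) (simp add: diff_divide_distrib[symmetric])
  qed
  finally show ?thesis
    unfolding strip_def by (intro integral_unique has_integral_of_real)
qed

text \<open>The integrand is constant and the strip has length \<pi>, which explains the factor
  \<open>1 / sqrt pi\<close> in \<open>wave\<close>.\<close>

lemma inner_at_wave_self: "inner_at t (wave \<omega> \<phi>) (wave \<omega> \<phi>) = 1"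
  by (simp add: inner_at_wave strip_def scaleR_conv_of_real)

section \<open>The modes as plane waves\<close>

abbreviation mode_phase :: "real \<Rightarrow> real \<Rightarrow> int \<Rightarrow> real" where
  "mode_phase \<beta>p \<beta>m j \<equiv> - (\<beta>p - \<beta>m) / 2 - (if odd j then pi / 2 else 0)"

lemma mode_eq_wave:
  "mode \<beta>p \<beta>m j = wave (freq \<beta>p \<beta>m j) (mode_phase \<beta>p \<beta>m j)"
proof (intro ext)
  fix t \<rho>
  define x where "x = freq \<beta>p \<beta>m j * \<rho> - (\<beta>p - \<beta>m) / 2"
  have "freq \<beta>p \<beta>m j * \<rho> + (- (\<beta>p - \<beta>m) / 2 - d) = x - d" for d
    by (simp add: x_def field_simps)
  then show "mode \<beta>p \<beta>m j t \<rho> = wave (freq \<beta>p \<beta>m j) (mode_phase \<beta>p \<beta>m j) t \<rho>"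
    by (simp only: mode_def wave_def Let_def x_def[symmetric])
      (simp add: vec2_eq_iff cos_diff sin_diff)
qed

lemma freq_add: "freq \<beta>p \<beta>m (j + k) = freq \<beta>p \<beta>m j + of_int k" "freq \<beta>p \<beta>m (j - k) = freq \<beta>p \<beta>m j - of_int k"
  by (simp_all add: freq_def)

lemma freq_inject [simp]: "freq \<beta>p \<beta>m j = freq \<beta>p \<beta>m k \<longleftrightarrow> j = k"
  by (simp add: freq_def)

lemma wave_minus_pi: "wave \<omega> (\<phi> - pi) = - wave \<omega> \<phi>"
  by (simp add: wave_def fun_eq_iff vec_eq_iff spinor_minus_pi add_diff_eq)

lemma mode_differentiable_fields: "mode \<beta>p \<beta>m j \<in> differentiable_fields"
  by (simp add: mode_eq_wave wave_differentiable_fields)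

lemma L0_mode: "L0 (mode \<beta>p \<beta>m j) = fscale (of_real (freq \<beta>p \<beta>m j)) (mode \<beta>p \<beta>m j)"
  by (simp add: mode_eq_wave L0_wave)

text \<open>Each ladder step lowers the phase by a quarter turn, while the phases of the modes
  alternate between two values. From an even index the phases match; from an odd index the result
  overshoots by \<pi>, which costs a sign by \<open>wave_minus_pi\<close>. This is the origin of the
  alternating factor.\<close>

lemma ladder_mode:
  assumes "\<sigma> = 1 \<or> \<sigma> = - 1"
  shows "ladder (of_int \<sigma>) (mode \<beta>p \<beta>m j) =
    fscale (\<i> * (- 1) powi (j + 1) * of_real (1 / 2 + of_int \<sigma> * freq \<beta>p \<beta>m j)) (mode \<beta>p \<beta>m (j + \<sigma>))"
proof -
  have \<sigma>: "real_of_int \<sigma> = 1 \<or> real_of_int \<sigma> = - 1" "odd \<sigma>"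
    using assms by auto
  show ?thesis
  proof (cases "even j")
    case True
    then show ?thesis
      unfolding mode_eq_wave ladder_wave[OF \<sigma>(1)] using \<sigma>(2) by (simp add: freq_add power_int_minus_one_minus)
  next
    case False
    define b where "b = - (\<beta>p - \<beta>m) / 2"
    have "b - pi / 2 - pi / 2 = b - pi"
      by simp
    with False show ?thesis
      unfolding mode_eq_wave ladder_wave[OF \<sigma>(1)] b_def[symmetric] using \<sigma>(2)
      by (simp add: freq_add wave_minus_pi fscale_def fun_eq_iff vec_eq_iff)
  qed
qed

text \<open>For distinct indices the integral is proportional to
  \<open>cos \<delta> * sin (of_int (j - k) * pi / 2)\<close>. The sine vanishes if the indices have
  equal parity; otherwise the phases differ by a quarter turn and the cosine vanishes.\<close>

lemma inner_at_mode: "inner_at t (mode \<beta>p \<beta>m j) (mode \<beta>p \<beta>m k) = (if j = k then 1 else 0)"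
proof (cases "j = k")
  case True
  then show ?thesis
    by (simp add: mode_eq_wave inner_at_wave_self)
next
  case False
  define \<delta> where "\<delta> = (if odd k then pi / 2 else 0) - (if odd j then pi / 2 else 0)"
  have ph: "- (\<beta>p - \<beta>m) / 2 - (if odd j then pi / 2 else 0) - (- (\<beta>p - \<beta>m) / 2 - (if odd k then pi / 2 else 0)) = \<delta>"
    by (simp add: \<delta>_def)
  have fr: "freq \<beta>p \<beta>m j - freq \<beta>p \<beta>m k = of_int (j - k)"
    by (simp add: freq_def)
  have "cos \<delta> * sin (of_int (j - k) * pi / 2) = 0"
  proof (cases "even (j - k)")
    case True
    then obtain m where "j - k = 2 * m" by blast
    then show ?thesis
      by (simp add: sin_zero_iff_int2)
  next
    case False
    then show ?thesis
      by (auto simp: \<delta>_def)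
  qed
  then have "integral strip (\<lambda>\<rho>. complex_of_real (cos (of_int (j - k) * \<rho> + \<delta>))) = 0"
    using False by (subst integral_cos_strip) auto
  then show ?thesis
    unfolding mode_eq_wave inner_at_wave ph fr using False by simp
qed

section \<open>Representations spanned by modes\<close>

lemma linear_on_fields_subset:
  "linear_on_fields W T \<Longrightarrow> V \<subseteq> W \<Longrightarrow> linear_on_fields V T"
  unfolding linear_on_fields_def by blast

lemma linear_on_fields_zero:
  assumes "linear_on_fields V T" and "0 \<in> V"
  shows "T 0 = 0"
proof -
  have "T (fscale (- 1) 0 + 0) = fscale (- 1) (T 0) + T 0"
    using assms unfolding linear_on_fields_def by blast
  then show ?thesis
    by simp
qed

lemma linear_on_fields_fscale:
  assumes "linear_on_fields V T" and "0 \<in> V" and "\<Psi> \<in> V"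
  shows "T (fscale c \<Psi>) = fscale c (T \<Psi>)"
  using assms linear_on_fields_zero[OF assms(1,2)] unfolding linear_on_fields_def
  by (metis add.right_neutral)

lemma linear_on_fields_comp:
  assumes "linear_on_fields V T" and "linear_on_fields W S" and "\<And>\<Psi>. \<Psi> \<in> V \<Longrightarrow> T \<Psi> \<in> W"
  shows "linear_on_fields V (\<lambda>\<Psi>. S (T \<Psi>))"
  using assms unfolding linear_on_fields_def by simp

lemma linear_on_fields_add:
  assumes "linear_on_fields V T" and "linear_on_fields V S"
  shows "linear_on_fields V (\<lambda>\<Psi>. T \<Psi> + S \<Psi>)"
  using assms unfolding linear_on_fields_def by (simp add: cvs.scale_right_distrib add_ac)

lemma linear_on_fields_scale:
  assumes "linear_on_fields V T"
  shows "linear_on_fields V (\<lambda>\<Psi>. fscale c (T \<Psi>))"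
  using assms unfolding linear_on_fields_def
  by (simp add: cvs.scale_right_distrib mult.commute)

lemma linear_on_fields_diff:
  assumes "linear_on_fields V T" and "linear_on_fields V S"
  shows "linear_on_fields V (\<lambda>\<Psi>. T \<Psi> - S \<Psi>)"
  using linear_on_fields_add[OF assms(1) linear_on_fields_scale[OF assms(2), of "- 1"]]
  by simp

lemma linear_on_fields_ident: "linear_on_fields V (\<lambda>\<Psi>. \<Psi>)"
  by (simp add: linear_on_fields_def)

lemma subspace_fieldsI:
  assumes "0 \<in> W" and "\<And>c x y. x \<in> W \<Longrightarrow> y \<in> W \<Longrightarrow> fscale c x + y \<in> W"
  shows "cvs.subspace W"
proof (rule cvs.subspaceI)
  show "x + y \<in> W" if "x \<in> W" "y \<in> W" for x y
    using assms(2)[OF that, of 1] by simp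
  show "fscale c x \<in> W" if "x \<in> W" for c x
    using assms(2)[OF that assms(1), of c] by simp
qed (rule assms(1))

text \<open>The elements of the span with image in \<open>W\<close> form a subspace containing the
  generators. This extends facts checked on modes to their span.\<close>

lemma linear_on_fields_span_into:
  assumes T: "linear_on_fields (cvs.span S) T" and W: "cvs.subspace W"
    and base: "\<And>e. e \<in> S \<Longrightarrow> T e \<in> W" and "\<Psi> \<in> cvs.span S"
  shows "T \<Psi> \<in> W"
proof -
  have "cvs.subspace {\<Psi> \<in> cvs.span S. T \<Psi> \<in> W}"
  proof (rule subspace_fieldsI)
    show "0 \<in> {\<Psi> \<in> cvs.span S. T \<Psi> \<in> W}"
      using linear_on_fields_zero[OF T] cvs.subspace_0[OF W] by (simp add: cvs.span_zero)
    fix c x y assume xy: "x \<in> {\<Psi> \<in> cvs.span S. T \<Psi> \<in> W}" "y \<in> {\<Psi> \<in> cvs.span S. T \<Psi> \<in> W}"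
    then have "T (fscale c x + y) = fscale c (T x) + T y"
      using T unfolding linear_on_fields_def by blast
    with xy show "fscale c x + y \<in> {\<Psi> \<in> cvs.span S. T \<Psi> \<in> W}"
      by (simp add: cvs.span_add cvs.span_scale cvs.subspace_add[OF W] cvs.subspace_scale[OF W])
  qed
  then have "cvs.span S \<subseteq> {\<Psi> \<in> cvs.span S. T \<Psi> \<in> W}"
    by (rule cvs.span_minimal[rotated]) (auto intro: base cvs.span_base)
  with assms(4) show ?thesis by blast
qed

text \<open>The difference of the two maps sends all generators into the zero subspace.\<close>

lemma linear_on_fields_span_eq:
  assumes "linear_on_fields (cvs.span S) T" and "linear_on_fields (cvs.span S) T'"
    and "\<And>e. e \<in> S \<Longrightarrow> T e = T' e" and "\<Psi> \<in> cvs.span S"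
  shows "T \<Psi> = T' \<Psi>"
proof -
  have "T \<Psi> - T' \<Psi> \<in> {0}"
    by (rule linear_on_fields_span_into[OF linear_on_fields_diff[OF assms(1,2)] cvs.subspace_single_0 _ assms(4)])
      (simp add: assms(3))
  then show ?thesis
    by simp
qed

text \<open>The relation is extended from generators to the span one argument at a time. The images
  must be differentiable too, so that the inner product is additive in them.\<close>

lemma inner_at_adjoint_span:
  assumes T: "linear_on_fields (cvs.span S) T" and T': "linear_on_fields (cvs.span S) T'"
    and D: "cvs.span S \<subseteq> differentiable_fields"
    and TD: "\<And>\<Psi>. \<Psi> \<in> cvs.span S \<Longrightarrow> T \<Psi> \<in> differentiable_fields"
    and T'D: "\<And>\<Psi>. \<Psi> \<in> cvs.span S \<Longrightarrow> T' \<Psi> \<in> differentiable_fields"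
    and basis: "\<And>e f. e \<in> S \<Longrightarrow> f \<in> S \<Longrightarrow> inner_at t (T e) f = - inner_at t e (T' f)"
    and "\<Psi>1 \<in> cvs.span S" and "\<Psi>2 \<in> cvs.span S"
  shows "inner_at t (T \<Psi>1) \<Psi>2 = - inner_at t \<Psi>1 (T' \<Psi>2)"
proof -
  have T0: "T 0 = 0" and T'0: "T' 0 = 0"
    using linear_on_fields_zero[OF T] linear_on_fields_zero[OF T'] by (simp_all add: cvs.span_zero)
  have Tadd: "T (fscale c x + y) = fscale c (T x) + T y" and T'add: "T' (fscale c x + y) = fscale c (T' x) + T' y"
    if "x \<in> cvs.span S" "y \<in> cvs.span S" for c x y
    using T T' that unfolding linear_on_fields_def by blast+
  have 1: "inner_at t (T \<Psi>1) f = - inner_at t \<Psi>1 (T' f)" if f: "f \<in> S" for f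
  proof -
    have f': "f \<in> differentiable_fields" "T' f \<in> differentiable_fields"
      using f D T'D cvs.span_base by blast+
    let ?W = "{\<Psi> \<in> cvs.span S. inner_at t (T \<Psi>) f = - inner_at t \<Psi> (T' f)}"
    have "cvs.subspace ?W"
    proof (rule subspace_fieldsI)
      show "0 \<in> ?W"
        by (simp add: T0 cvs.span_zero)
      fix c x y assume xy: "x \<in> ?W" "y \<in> ?W"
      then have "x \<in> differentiable_fields" "y \<in> differentiable_fields"
        "T x \<in> differentiable_fields" "T y \<in> differentiable_fields"
        using D TD by auto
      with xy f' show "fscale c x + y \<in> ?W"
        by (simp add: cvs.span_add cvs.span_scale inner_at_fscale_add_left Tadd)
    qed
    then have "cvs.span S \<subseteq> ?W"
      by (rule cvs.span_minimal[rotated]) (auto intro: basis f cvs.span_base)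
    with assms(7) show ?thesis by blast
  qed
  have \<Psi>1: "\<Psi>1 \<in> differentiable_fields" "T \<Psi>1 \<in> differentiable_fields"
    using D TD assms(7) by blast+
  let ?W = "{\<Psi> \<in> cvs.span S. inner_at t (T \<Psi>1) \<Psi> = - inner_at t \<Psi>1 (T' \<Psi>)}"
  have "cvs.subspace ?W"
  proof (rule subspace_fieldsI)
    show "0 \<in> ?W"
      by (simp add: T'0 cvs.span_zero)
    fix c x y assume xy: "x \<in> ?W" "y \<in> ?W"
    then have "x \<in> differentiable_fields" "y \<in> differentiable_fields"
      "T' x \<in> differentiable_fields" "T' y \<in> differentiable_fields"
      using D T'D by auto
    with xy \<Psi>1 show "fscale c x + y \<in> ?W"
      by (simp add: cvs.span_add cvs.span_scale inner_at_fscale_add_right T'add)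
  qed
  then have "cvs.span S \<subseteq> ?W"
    by (rule cvs.span_minimal[rotated]) (auto intro: 1 cvs.span_base)
  with assms(8) show ?thesis by blast
qed

section \<open>The operators on spans of modes\<close>

abbreviation mode_span :: "real \<Rightarrow> real \<Rightarrow> int set \<Rightarrow> spinor_field set" where
  "mode_span \<beta>p \<beta>m J \<equiv> cvs.span (mode \<beta>p \<beta>m ` J)"

lemma mode_span_differentiable: "mode_span \<beta>p \<beta>m J \<subseteq> differentiable_fields"
  by (rule cvs.span_minimal) (auto simp: mode_differentiable_fields subspace_differentiable_fields)

lemmas linear_on_mode_span =
  linear_on_fields_subset[OF linear_on_fields_L0 mode_span_differentiable]
  linear_on_fields_subset[OF linear_on_fields_ladder mode_span_differentiable]

lemma fscale_differentiable_fields: "\<Psi> \<in> differentiable_fields \<Longrightarrow> fscale c \<Psi> \<in> differentiable_fields"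
  by (rule cvs.subspace_scale[OF subspace_differentiable_fields])

lemma ladder_fscale_mode:
  "ladder \<sigma> (fscale c (mode \<beta>p \<beta>m j)) = fscale c (ladder \<sigma> (mode \<beta>p \<beta>m j))"
  by (rule linear_on_fields_fscale[OF linear_on_fields_ladder zero_differentiable_fields mode_differentiable_fields])

lemma L0_fscale_mode: "L0 (fscale c (mode \<beta>p \<beta>m j)) = fscale c (L0 (mode \<beta>p \<beta>m j))"
  by (rule linear_on_fields_fscale[OF linear_on_fields_L0 zero_differentiable_fields mode_differentiable_fields])

lemma Lp_mode:
  "Lp (mode \<beta>p \<beta>m j) =
     fscale (\<i> * (- 1) powi (j + 1) * of_real (1 / 2 + freq \<beta>p \<beta>m j)) (mode \<beta>p \<beta>m (j + 1))"
  using ladder_mode[of 1] by simp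

lemma Lm_mode:
  "Lm (mode \<beta>p \<beta>m j) =
     fscale (\<i> * (- 1) powi (j + 1) * of_real (1 / 2 - freq \<beta>p \<beta>m j)) (mode \<beta>p \<beta>m (j - 1))"
  using ladder_mode[of "- 1"] by simp

text \<open>The signs of neighbouring indices are opposite and compensate the square of
  \<open>\<i>\<close>, while the two linear factors agree up to sign. The commutator and the Casimir
  both reduce to this eigenvalue and that of \<open>Lm_Lp_mode\<close>.\<close>

lemma Lp_Lm_mode:
  "Lp (Lm (mode \<beta>p \<beta>m j)) = fscale (- of_real ((freq \<beta>p \<beta>m j - 1 / 2)\<^sup>2)) (mode \<beta>p \<beta>m j)"
proof -
  have "\<i> * (- 1) powi (j + 1) * of_real (1 / 2 - \<omega>) * (\<i> * (- 1) powi (j - 1 + 1) * of_real (1 / 2 + (\<omega> - 1)))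
      = - complex_of_real ((\<omega> - 1 / 2)\<^sup>2)" for \<omega>
    by (cases "even j") (simp_all add: power2_eq_square algebra_simps)
  then show ?thesis
    unfolding Lm_mode ladder_fscale_mode Lp_mode cvs.scale_scale freq_add by simp
qed

lemma Lm_Lp_mode:
  "Lm (Lp (mode \<beta>p \<beta>m j)) = fscale (- of_real ((freq \<beta>p \<beta>m j + 1 / 2)\<^sup>2)) (mode \<beta>p \<beta>m j)"
proof -
  have "\<i> * (- 1) powi (j + 1) * of_real (1 / 2 + \<omega>) * (\<i> * (- 1) powi (j + 1 + 1) * of_real (1 / 2 - (\<omega> + 1)))
      = - complex_of_real ((\<omega> + 1 / 2)\<^sup>2)" for \<omega>
    by (cases "even j") (simp_all add: power2_eq_square algebra_simps)
  then show ?thesis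
    unfolding Lm_mode ladder_fscale_mode Lp_mode cvs.scale_scale freq_add by simp
qed

text \<open>\<open>L\<^sub>+\<close> kills the mode of frequency \<open>-1/2\<close> and \<open>L\<^sub>-\<close> the mode of frequency \<open>1/2\<close>; these are
  the only places where the ladder of modes can break.\<close>

definition ladder_closed :: "real \<Rightarrow> real \<Rightarrow> int set \<Rightarrow> bool" where
  "ladder_closed \<beta>p \<beta>m J \<longleftrightarrow>
     (\<forall>j\<in>J. (freq \<beta>p \<beta>m j \<noteq> - 1 / 2 \<longrightarrow> j + 1 \<in> J) \<and> (freq \<beta>p \<beta>m j \<noteq> 1 / 2 \<longrightarrow> j - 1 \<in> J))"

text \<open>A ladder operator either meets a vanishing coefficient or leads to a mode whose index
  lies in \<open>J\<close> by closedness.\<close>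

lemma mode_span_closed:
  assumes "ladder_closed \<beta>p \<beta>m J" and "\<Psi> \<in> mode_span \<beta>p \<beta>m J"
  shows "L0 \<Psi> \<in> mode_span \<beta>p \<beta>m J" and "Lp \<Psi> \<in> mode_span \<beta>p \<beta>m J" and "Lm \<Psi> \<in> mode_span \<beta>p \<beta>m J"
proof -
  have scale: "fscale c (mode \<beta>p \<beta>m j) \<in> mode_span \<beta>p \<beta>m J" if "j \<in> J" for c j
    using that by (intro cvs.span_scale[OF cvs.span_base] imageI)
  show "L0 \<Psi> \<in> mode_span \<beta>p \<beta>m J"
    by (rule linear_on_fields_span_into[OF linear_on_mode_span(1) cvs.subspace_span _ assms(2)])
      (use scale in \<open>auto simp: L0_mode\<close>)
  have "Lp (mode \<beta>p \<beta>m j) \<in> mode_span \<beta>p \<beta>m J" if "j \<in> J" for j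
  proof (cases "freq \<beta>p \<beta>m j = - 1 / 2")
    case True
    then show ?thesis by (simp add: Lp_mode cvs.span_zero)
  next
    case False
    then have "j + 1 \<in> J" using assms(1) that by (simp add: ladder_closed_def)
    then show ?thesis unfolding Lp_mode by (rule scale)
  qed
  then show "Lp \<Psi> \<in> mode_span \<beta>p \<beta>m J"
    by (intro linear_on_fields_span_into[OF linear_on_mode_span(2) cvs.subspace_span _ assms(2)]) auto
  have "Lm (mode \<beta>p \<beta>m j) \<in> mode_span \<beta>p \<beta>m J" if "j \<in> J" for j
  proof (cases "freq \<beta>p \<beta>m j = 1 / 2")
    case True
    then show ?thesis unfolding Lm_mode by (simp only: diff_self) (simp add: cvs.span_zero)
  next
    case False
    then have "j - 1 \<in> J" using assms(1) that by (simp add: ladder_closed_def)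
    then show ?thesis unfolding Lm_mode by (rule scale)
  qed
  then show "Lm \<Psi> \<in> mode_span \<beta>p \<beta>m J"
    by (intro linear_on_fields_span_into[OF linear_on_mode_span(2) cvs.subspace_span _ assms(2)]) auto
qed

lemma linear_on_mode_span_comp:
  assumes "ladder_closed \<beta>p \<beta>m J"
  shows "linear_on_fields (mode_span \<beta>p \<beta>m J) (\<lambda>\<Psi>. L0 (L0 \<Psi>))"
    and "linear_on_fields (mode_span \<beta>p \<beta>m J) (\<lambda>\<Psi>. L0 (Lp \<Psi>))"
    and "linear_on_fields (mode_span \<beta>p \<beta>m J) (\<lambda>\<Psi>. L0 (Lm \<Psi>))"
    and "linear_on_fields (mode_span \<beta>p \<beta>m J) (\<lambda>\<Psi>. Lp (L0 \<Psi>))"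
    and "linear_on_fields (mode_span \<beta>p \<beta>m J) (\<lambda>\<Psi>. Lm (L0 \<Psi>))"
    and "linear_on_fields (mode_span \<beta>p \<beta>m J) (\<lambda>\<Psi>. Lp (Lm \<Psi>))"
    and "linear_on_fields (mode_span \<beta>p \<beta>m J) (\<lambda>\<Psi>. Lm (Lp \<Psi>))"
  \<comment> \<open>Both factors are instantiated explicitly, since unification could split each
    composite in several ways.\<close>
  by - (rule linear_on_fields_comp[where T = L0 and S = L0, OF linear_on_mode_span(1) linear_on_mode_span(1)
        mode_span_closed(1)[OF assms]], assumption,
      rule linear_on_fields_comp[where T = Lp and S = L0, OF linear_on_mode_span(2) linear_on_mode_span(1)
        mode_span_closed(2)[OF assms]], assumption,
      rule linear_on_fields_comp[where T = Lm and S = L0, OF linear_on_mode_span(2) linear_on_mode_span(1)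
        mode_span_closed(3)[OF assms]], assumption,
      rule linear_on_fields_comp[where T = L0 and S = Lp, OF linear_on_mode_span(1) linear_on_mode_span(2)
        mode_span_closed(1)[OF assms]], assumption,
      rule linear_on_fields_comp[where T = L0 and S = Lm, OF linear_on_mode_span(1) linear_on_mode_span(2)
        mode_span_closed(1)[OF assms]], assumption,
      rule linear_on_fields_comp[where T = Lm and S = Lp, OF linear_on_mode_span(2) linear_on_mode_span(2)
        mode_span_closed(3)[OF assms]], assumption,
      rule linear_on_fields_comp[where T = Lp and S = Lm, OF linear_on_mode_span(2) linear_on_mode_span(2)
        mode_span_closed(2)[OF assms]], assumption)

text \<open>Both sides of each commutation relation are linear on the span, so it suffices to
  compare coefficients on a single mode.\<close>

lemma representation_mode_span:
  assumes "ladder_closed \<beta>p \<beta>m J"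
  shows "representation (mode_span \<beta>p \<beta>m J)"
  unfolding representation_def
proof (intro conjI ballI allI)
  note lin = linear_on_fields_diff linear_on_fields_scale linear_on_mode_span linear_on_mode_span_comp[OF assms]
  show "mode_span \<beta>p \<beta>m J \<subseteq> spinor_fields"
    using mode_span_differentiable by (auto simp: differentiable_fields_def)
  show "invariant (mode_span \<beta>p \<beta>m J)"
    using mode_span_closed[OF assms] by (simp add: invariant_def)
  fix \<Psi> assume \<Psi>: "\<Psi> \<in> mode_span \<beta>p \<beta>m J"
  then have "\<Psi> \<in> differentiable_fields"
    using mode_span_differentiable by blast
  then show "(\<lambda>s. \<Psi> s \<rho>) differentiable (at t)" "(\<lambda>r. \<Psi> t r) differentiable (at \<rho> within strip)"
    if "\<rho> \<in> strip" for t \<rho>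
    using that by (auto simp: differentiable_fields_def)
  show "L0 (Lp \<Psi>) - Lp (L0 \<Psi>) = Lp \<Psi>"
  proof (rule linear_on_fields_span_eq[OF _ _ _ \<Psi>])
    fix e assume "e \<in> mode \<beta>p \<beta>m ` J"
    then obtain j where e: "e = mode \<beta>p \<beta>m j" by blast
    have eq: "a * (of_real (\<omega> + 1) :: complex) - of_real \<omega> * a = a" for a \<omega>
      by (simp add: algebra_simps)
    show "L0 (Lp e) - Lp (L0 e) = Lp e"
      using eq unfolding e Lp_mode L0_mode L0_fscale_mode ladder_fscale_mode cvs.scale_scale
      by (simp only: cvs.scale_left_diff_distrib[symmetric] freq_add of_int_1)
  qed (intro lin)+
  show "L0 (Lm \<Psi>) - Lm (L0 \<Psi>) = - Lm \<Psi>"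
  proof -
    \<comment> \<open>The negative is written as a multiple so that
      \<open>linear_on_fields_scale\<close> applies to the right-hand side.\<close>
    have "L0 (Lm \<Psi>) - Lm (L0 \<Psi>) = fscale (- 1) (Lm \<Psi>)"
    proof (rule linear_on_fields_span_eq[OF _ _ _ \<Psi>])
      fix e assume "e \<in> mode \<beta>p \<beta>m ` J"
      then obtain j where e: "e = mode \<beta>p \<beta>m j" by blast
      have eq: "a * (of_real (\<omega> - 1) :: complex) - of_real \<omega> * a = - 1 * a" for a \<omega>
        by (simp add: algebra_simps)
      show "L0 (Lm e) - Lm (L0 e) = fscale (- 1) (Lm e)"
        using eq unfolding e Lm_mode L0_mode L0_fscale_mode ladder_fscale_mode cvs.scale_scale
        by (simp only: cvs.scale_left_diff_distrib[symmetric] freq_add of_int_1)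
    qed (intro lin)+
    then show ?thesis by simp
  qed
  show "Lp (Lm \<Psi>) - Lm (Lp \<Psi>) = fscale 2 (L0 \<Psi>)"
  proof (rule linear_on_fields_span_eq[OF _ _ _ \<Psi>])
    fix e assume "e \<in> mode \<beta>p \<beta>m ` J"
    then obtain j where e: "e = mode \<beta>p \<beta>m j" by blast
    have eq: "- (of_real ((\<omega> - 1 / 2)\<^sup>2) :: complex) - - of_real ((\<omega> + 1 / 2)\<^sup>2) = 2 * of_real \<omega>" for \<omega>
      by (simp add: power2_eq_square algebra_simps)
    show "Lp (Lm e) - Lm (Lp e) = fscale 2 (L0 e)"
      unfolding e Lp_Lm_mode Lm_Lp_mode L0_mode cvs.scale_scale
      by (simp only: cvs.scale_left_diff_distrib[symmetric] eq)
  qed (intro lin)+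
qed (rule cvs.subspace_span)

text \<open>On a mode of frequency \<omega> the squares of \<open>\<omega> - 1 / 2\<close> and
  \<open>\<omega> + 1 / 2\<close>, halved and subtracted from the square of \<omega>, leave
  \<open>- 1 / 4\<close> whatever \<omega> is.\<close>

lemma casimir_mode_span:
  assumes "ladder_closed \<beta>p \<beta>m J" and \<Psi>: "\<Psi> \<in> mode_span \<beta>p \<beta>m J"
  shows "casimir \<Psi> = fscale (- 1 / 4) \<Psi>"
  unfolding casimir_def
proof (rule linear_on_fields_span_eq[where T' = "fscale (- 1 / 4)", OF _ _ _ \<Psi>])
  fix e assume "e \<in> mode \<beta>p \<beta>m ` J"
  then obtain j where e: "e = mode \<beta>p \<beta>m j" by blast
  have eq: "of_real \<omega> * of_real \<omega> + 1 / 2 * (- (of_real ((\<omega> - 1 / 2)\<^sup>2) :: complex) + - of_real ((\<omega> + 1 / 2)\<^sup>2)) = - 1 / 4" for \<omega>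
    by (simp add: power2_eq_square field_simps)
  show "L0 (L0 e) + fscale (1 / 2) (Lp (Lm e) + Lm (Lp e)) = fscale (- 1 / 4) e"
    unfolding e Lp_Lm_mode Lm_Lp_mode L0_mode L0_fscale_mode cvs.scale_scale
    by (simp only: cvs.scale_left_distrib[symmetric] cvs.scale_scale eq)
qed (intro linear_on_fields_add linear_on_fields_scale linear_on_fields_ident linear_on_mode_span_comp assms)+

lemma inner_at_fscale_mode:
  "inner_at t (fscale c (mode \<beta>p \<beta>m j)) (mode \<beta>p \<beta>m k) = (if j = k then cnj c else 0)"
  "inner_at t (mode \<beta>p \<beta>m j) (fscale c (mode \<beta>p \<beta>m k)) = (if j = k then c else 0)"
  using inner_at_fscale_add_left[OF mode_differentiable_fields mode_differentiable_fields zero_differentiable_fields, of t c]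
    inner_at_fscale_add_right[OF mode_differentiable_fields mode_differentiable_fields zero_differentiable_fields, of t _ _ _ c]
  by (simp_all add: inner_at_mode)

text \<open>Equal modes with distinct indices would be both orthogonal and normalized.\<close>

lemma inj_mode: "inj (mode \<beta>p \<beta>m)"
  by (rule injI) (metis inner_at_mode zero_neq_one)

lemma mode_nonzero [simp]: "mode \<beta>p \<beta>m j \<noteq> 0"
  by (metis inner_at_mode inner_at_zero(1) zero_neq_one)

text \<open>Both sides vanish unless \<open>k = j + 1\<close>. In that case the coefficient
  \<open>1 / 2 - freq \<beta>p \<beta>m k\<close> is the negative of
  \<open>1 / 2 + freq \<beta>p \<beta>m j\<close>, and the alternating sign and the conjugated
  \<open>\<i>\<close> account for the rest.\<close>

lemma inner_at_Lp_mode: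
  "inner_at t (Lp (mode \<beta>p \<beta>m j)) (mode \<beta>p \<beta>m k) = - inner_at t (mode \<beta>p \<beta>m j) (Lm (mode \<beta>p \<beta>m k))"
  unfolding Lp_mode Lm_mode inner_at_fscale_mode by (cases "even j") (auto simp: freq_def)

lemma unitary_rep_mode_span:
  assumes "ladder_closed \<beta>p \<beta>m J"
  shows "unitary_rep (mode_span \<beta>p \<beta>m J)"
  unfolding unitary_rep_def
proof (intro conjI allI ballI)
  show "\<exists>E. cvs.span E = mode_span \<beta>p \<beta>m J \<and> (\<forall>e\<in>E. \<exists>c. L0 e = fscale c e) \<and>
      (\<forall>t. \<forall>e\<in>E. \<forall>f\<in>E. inner_at t e f = (if e = f then 1 else 0))"
  proof (intro exI[of _ "mode \<beta>p \<beta>m ` J"] conjI ballI allI refl)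
    show "\<exists>c. L0 e = fscale c e" if "e \<in> mode \<beta>p \<beta>m ` J" for e
      using that L0_mode by blast
    show "inner_at t e f = (if e = f then 1 else 0)"
      if "e \<in> mode \<beta>p \<beta>m ` J" "f \<in> mode \<beta>p \<beta>m ` J" for t e f
      using that by (auto simp: inner_at_mode inj_eq[OF inj_mode])
  qed
  fix t \<Psi>1 \<Psi>2
  assume \<Psi>: "\<Psi>1 \<in> mode_span \<beta>p \<beta>m J" "\<Psi>2 \<in> mode_span \<beta>p \<beta>m J"
  have adj: "inner_at t (Lp \<Psi>1) \<Psi>2 = - inner_at t \<Psi>1 (Lm \<Psi>2)"
    if "\<Psi>1 \<in> mode_span \<beta>p \<beta>m J" "\<Psi>2 \<in> mode_span \<beta>p \<beta>m J" for \<Psi>1 \<Psi>2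
  proof (rule inner_at_adjoint_span[OF linear_on_mode_span(2) linear_on_mode_span(2) mode_span_differentiable _ _ _ that])
    show "Lp \<Psi> \<in> differentiable_fields" "Lm \<Psi> \<in> differentiable_fields"
      if "\<Psi> \<in> mode_span \<beta>p \<beta>m J" for \<Psi>
      using mode_span_closed(2,3)[OF assms that] mode_span_differentiable by blast+
    show "inner_at t (Lp e) f = - inner_at t e (Lm f)"
      if "e \<in> mode \<beta>p \<beta>m ` J" "f \<in> mode \<beta>p \<beta>m ` J" for e f
      using that inner_at_Lp_mode by blast
  qed
  show "inner_at t (Lp \<Psi>1) \<Psi>2 = - inner_at t \<Psi>1 (Lm \<Psi>2)"
    using adj \<Psi> .
  \<comment> \<open>The second adjoint relation is the complex conjugate of the first with the two
    arguments exchanged.\<close>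
  show "inner_at t (Lm \<Psi>1) \<Psi>2 = - inner_at t \<Psi>1 (Lp \<Psi>2)"
    using arg_cong[OF adj[OF \<Psi>(2,1)], of cnj] by (simp add: cnj_inner_at)
qed (rule representation_mode_span[OF assms])

section \<open>Decomposition into modes, simple spectrum and irreducibility\<close>

lemma mode_span_obtain:
  assumes "\<Psi> \<in> mode_span \<beta>p \<beta>m J"
  obtains F a where "finite F" "F \<subseteq> J" "\<Psi> = (\<Sum>j\<in>F. fscale (a j) (mode \<beta>p \<beta>m j))"
proof -
  obtain t r where t: "finite t" "t \<subseteq> mode \<beta>p \<beta>m ` J" "\<Psi> = (\<Sum>e\<in>t. fscale (r e) e)"
    using assms unfolding cvs.span_explicit mem_Collect_eq by (elim exE conjE) (rule that)
  from finite_subset_image[OF t(1,2)] obtain F where F: "F \<subseteq> J" "finite F" "t = mode \<beta>p \<beta>m ` F"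
    by blast
  \<comment> \<open>Injectivity of \<open>mode\<close> allows the finite combination to be indexed
    by integers instead of fields.\<close>
  moreover have "\<Psi> = (\<Sum>j\<in>F. fscale (r (mode \<beta>p \<beta>m j)) (mode \<beta>p \<beta>m j))"
    unfolding t(3) F(3) sum.reindex[OF inj_on_subset[OF inj_mode subset_UNIV]] o_def ..
  ultimately show ?thesis
    by (intro that)
qed

lemma L0_sum_modes:
  "finite F \<Longrightarrow> L0 (\<Sum>j\<in>F. fscale (a j) (mode \<beta>p \<beta>m j)) =
     (\<Sum>j\<in>F. fscale (a j * of_real (freq \<beta>p \<beta>m j)) (mode \<beta>p \<beta>m j))"
proof (induction F rule: finite_induct)
  case empty
  then show ?case
    by (simp only: sum.empty linear_on_fields_zero[OF linear_on_fields_L0 zero_differentiable_fields])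
next
  case (insert k F)
  have D: "(\<Sum>j\<in>F. fscale (a j) (mode \<beta>p \<beta>m j)) \<in> differentiable_fields"
    by (intro cvs.subspace_sum[OF subspace_differentiable_fields] fscale_differentiable_fields mode_differentiable_fields)
  have "L0 (fscale (a k) (mode \<beta>p \<beta>m k) + (\<Sum>j\<in>F. fscale (a j) (mode \<beta>p \<beta>m j))) =
      fscale (a k) (L0 (mode \<beta>p \<beta>m k)) + L0 (\<Sum>j\<in>F. fscale (a j) (mode \<beta>p \<beta>m j))"
    by (rule linear_on_fields_L0[unfolded linear_on_fields_def, rule_format, OF mode_differentiable_fields D])
  then show ?case
    unfolding sum.insert[OF insert.hyps] insert.IH L0_mode cvs.scale_scale .
qed

text \<open>\<open>L\<^sub>0 - \<omega>\<^sub>k\<close> removes the \<open>k\<close>-th component and rescales the others by non-zero factors.\<close>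

lemma L0_invariant_components:
  assumes "finite F" and W: "cvs.subspace W" and L0: "\<And>\<Psi>. \<Psi> \<in> W \<Longrightarrow> L0 \<Psi> \<in> W"
    and "(\<Sum>j\<in>F. fscale (a j) (mode \<beta>p \<beta>m j)) \<in> W"
  shows "\<forall>j\<in>F. fscale (a j) (mode \<beta>p \<beta>m j) \<in> W"
  using assms(1,4)
proof (induction F arbitrary: a rule: finite_induct)
  case (insert k F)
  let ?m = "mode \<beta>p \<beta>m" and ?w = "\<lambda>j. complex_of_real (freq \<beta>p \<beta>m j)"
  let ?\<Psi> = "\<Sum>j\<in>insert k F. fscale (a j) (?m j)"
  have "L0 ?\<Psi> - fscale (?w k) ?\<Psi> \<in> W"
    using insert.prems by (intro cvs.subspace_diff cvs.subspace_scale W L0)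
  also have "L0 ?\<Psi> - fscale (?w k) ?\<Psi> = (\<Sum>j\<in>insert k F. fscale (a j * (?w j - ?w k)) (?m j))"
    using insert.hyps(1)
    by (simp only: L0_sum_modes finite.insertI cvs.scale_sum_right sum_subtractf[symmetric] cvs.scale_scale
        cvs.scale_left_diff_distrib[symmetric] right_diff_distrib mult.commute[of "?w k"])
  also have "\<dots> = (\<Sum>j\<in>F. fscale (a j * (?w j - ?w k)) (?m j))"
    using insert.hyps by simp
  finally have IH: "\<forall>j\<in>F. fscale (a j * (?w j - ?w k)) (?m j) \<in> W"
    by (rule insert.IH)
  have F: "fscale (a j) (?m j) \<in> W" if "j \<in> F" for j
  proof -
    have "?w j - ?w k \<noteq> 0"
      using that insert.hyps(2) by auto
    then have "fscale (a j) (?m j) = fscale (1 / (?w j - ?w k)) (fscale (a j * (?w j - ?w k)) (?m j))"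
      unfolding cvs.scale_scale by simp
    also have "\<dots> \<in> W"
      by (rule cvs.subspace_scale[OF W bspec[OF IH that]])
    finally show ?thesis .
  qed
  have "?\<Psi> - (\<Sum>j\<in>F. fscale (a j) (?m j)) \<in> W"
    by (rule cvs.subspace_diff[OF W insert.prems cvs.subspace_sum[OF W F]])
  then have "fscale (a k) (?m k) \<in> W"
    unfolding sum.insert[OF insert.hyps] by simp
  with F show ?case
    by blast
qed simp

text \<open>The eigenvectors for \<open>c\<close> form a subspace invariant under \<open>L0\<close>,
  so by \<open>L0_invariant_components\<close> it contains every component of each of its elements
  in the span. A non-zero component that is itself an eigenvector for \<open>c\<close> must have
  frequency \<open>c\<close>.\<close>

lemma L0_eigenspace_mode_span:
  "L0_eigenspace (mode_span \<beta>p \<beta>m J) c = mode_span \<beta>p \<beta>m {j \<in> J. of_real (freq \<beta>p \<beta>m j) = c}"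
proof (intro equalityI subsetI)
  let ?J = "{j \<in> J. of_real (freq \<beta>p \<beta>m j) = c}"
  fix \<Psi> assume \<Psi>: "\<Psi> \<in> mode_span \<beta>p \<beta>m ?J"
  have "mode_span \<beta>p \<beta>m ?J \<subseteq> mode_span \<beta>p \<beta>m J"
    by (intro cvs.span_mono) auto
  moreover have "L0 \<Psi> = fscale c \<Psi>"
    by (rule linear_on_fields_span_eq[OF _ _ _ \<Psi>])
      (auto intro: linear_on_mode_span linear_on_fields_scale linear_on_fields_ident simp: L0_mode)
  ultimately show "\<Psi> \<in> L0_eigenspace (mode_span \<beta>p \<beta>m J) c"
    using \<Psi> by (auto simp: L0_eigenspace_def)
next
  let ?J = "{j \<in> J. of_real (freq \<beta>p \<beta>m j) = c}"
  define W where "W = {\<Psi> \<in> differentiable_fields. L0 \<Psi> = fscale c \<Psi>}"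
  fix \<Psi> assume "\<Psi> \<in> L0_eigenspace (mode_span \<beta>p \<beta>m J) c"
  then have \<Psi>: "\<Psi> \<in> mode_span \<beta>p \<beta>m J" "\<Psi> \<in> W"
    using mode_span_differentiable by (auto simp: L0_eigenspace_def W_def)
  have step: "fscale b x + y \<in> W" if "x \<in> W" "y \<in> W" for b x y
  proof -
    have "L0 (fscale b x + y) = fscale b (L0 x) + L0 y"
      using that linear_on_fields_L0 by (simp add: W_def linear_on_fields_def)
    then show ?thesis
      using that differentiable_fields_fscale_add by (simp add: W_def cvs.scale_right_distrib mult.commute)
  qed
  have "0 \<in> W"
    using linear_on_fields_zero[OF linear_on_fields_L0] zero_differentiable_fields by (simp add: W_def)
  then have sub: "cvs.subspace W"
    using step by (rule subspace_fieldsI)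
  have inv: "L0 \<Psi> \<in> W" if "\<Psi> \<in> W" for \<Psi>
    using that cvs.subspace_scale[OF sub that, of c] by (simp add: W_def)
  obtain F a where F: "finite F" "F \<subseteq> J" "\<Psi> = (\<Sum>j\<in>F. fscale (a j) (mode \<beta>p \<beta>m j))"
    using mode_span_obtain[OF \<Psi>(1)] by metis
  have "fscale (a j) (mode \<beta>p \<beta>m j) \<in> mode_span \<beta>p \<beta>m ?J" if j: "j \<in> F" for j
  proof (cases "a j = 0")
    case True
    then show ?thesis by (simp add: cvs.span_zero)
  next
    case False
    have "fscale (a j) (mode \<beta>p \<beta>m j) \<in> W"
      using L0_invariant_components[OF F(1) sub inv] \<Psi>(2) F(3) j by blast
    then have "fscale (a j * (of_real (freq \<beta>p \<beta>m j) - c)) (mode \<beta>p \<beta>m j) = 0"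
      by (simp add: W_def L0_fscale_mode L0_mode cvs.scale_left_diff_distrib right_diff_distrib mult.commute)
    with False have "of_real (freq \<beta>p \<beta>m j) = c"
      by simp
    with j F(2) show ?thesis
      by (intro cvs.span_scale cvs.span_base) auto
  qed
  then show "\<Psi> \<in> mode_span \<beta>p \<beta>m ?J"
    unfolding F(3) by (rule cvs.span_sum)
qed

text \<open>Distinct indices have distinct frequencies, so every non-trivial eigenspace is spanned
  by one mode.\<close>

lemma simple_L0_spectrum_mode_span: "simple_L0_spectrum (mode_span \<beta>p \<beta>m J) (freq \<beta>p \<beta>m ` J)"
proof -
  have single: "{j' \<in> J. complex_of_real (freq \<beta>p \<beta>m j') = of_real (freq \<beta>p \<beta>m j)} = {j}" if "j \<in> J" for j
    using that by auto
  have spectrum: "L0_eigenspace (mode_span \<beta>p \<beta>m J) c \<noteq> {0} \<longleftrightarrow> c \<in> complex_of_real ` freq \<beta>p \<beta>m ` J" for c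
  proof (cases "c \<in> complex_of_real ` freq \<beta>p \<beta>m ` J")
    case True
    then obtain j where j: "j \<in> J" "c = of_real (freq \<beta>p \<beta>m j)" by blast
    have "mode \<beta>p \<beta>m j \<in> L0_eigenspace (mode_span \<beta>p \<beta>m J) c"
      unfolding L0_eigenspace_mode_span j(2) single[OF j(1)] by (simp add: cvs.span_base)
    then have "L0_eigenspace (mode_span \<beta>p \<beta>m J) c \<noteq> {0}"
      by (metis mode_nonzero singletonD)
    with True show ?thesis
      by blast
  next
    case False
    then have empty: "{j \<in> J. of_real (freq \<beta>p \<beta>m j) = c} = {}" by blast
    show ?thesis
      unfolding L0_eigenspace_mode_span empty using False by simp
  qed
  have dim: "cvs.dim (L0_eigenspace (mode_span \<beta>p \<beta>m J) (of_real (freq \<beta>p \<beta>m j))) = 1" if "j \<in> J" for j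
  proof -
    have "\<not> cvs.dependent {mode \<beta>p \<beta>m j}"
      unfolding cvs.dependent_single by (rule mode_nonzero)
    then have "cvs.dim (cvs.span {mode \<beta>p \<beta>m j}) = card {mode \<beta>p \<beta>m j}"
      by (rule cvs.dim_span_eq_card_independent)
    then show ?thesis
      unfolding L0_eigenspace_mode_span single[OF that] image_insert image_empty by simp
  qed
  show ?thesis
    unfolding simple_L0_spectrum_def spectrum Collect_mem_eq using dim by blast
qed

text \<open>A non-zero invariant subspace contains some mode \<open>i\<close>, from which the ladder
  reaches all of \<open>J\<close>, an interval of integers. One condition per link suffices: the
  coefficient upwards from \<open>j\<close> and that downwards from \<open>j + 1\<close> vanish
  together, namely at frequency \<open>- 1 / 2\<close> of \<open>j\<close>.\<close>

lemma irreducible_rep_mode_span: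
  assumes closed: "ladder_closed \<beta>p \<beta>m J" and "J \<noteq> {}"
    and convex: "\<And>i j k. i \<in> J \<Longrightarrow> k \<in> J \<Longrightarrow> i \<le> j \<Longrightarrow> j \<le> k \<Longrightarrow> j \<in> J"
    and unbroken: "\<And>j. j \<in> J \<Longrightarrow> j + 1 \<in> J \<Longrightarrow> freq \<beta>p \<beta>m j \<noteq> - 1 / 2"
  shows "irreducible_rep (mode_span \<beta>p \<beta>m J)"
  unfolding irreducible_rep_def
proof (intro conjI allI impI)
  let ?m = "mode \<beta>p \<beta>m"
  show "representation (mode_span \<beta>p \<beta>m J)"
    by (rule representation_mode_span[OF closed])
  obtain j0 where "j0 \<in> J" using \<open>J \<noteq> {}\<close> by blast
  then have "?m j0 \<in> mode_span \<beta>p \<beta>m J" by (simp add: cvs.span_base)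
  then show "mode_span \<beta>p \<beta>m J \<noteq> {0}"
    using mode_nonzero by blast
  fix W assume "cvs.subspace W \<and> W \<subseteq> mode_span \<beta>p \<beta>m J \<and> invariant W"
  then have W: "cvs.subspace W" and WV: "W \<subseteq> mode_span \<beta>p \<beta>m J" and inv: "invariant W"
    by auto
  have scaleD: "?m j \<in> W" if "fscale c (?m j) \<in> W" "c \<noteq> 0" for c j
    using cvs.subspace_scale[OF W that(1), of "1 / c"] that(2) by simp
  have coeff: "\<i> * (- 1) powi n * complex_of_real x \<noteq> 0" if "x \<noteq> 0" for n x
    using that by simp
  show "W = {0} \<or> W = mode_span \<beta>p \<beta>m J"
  proof (cases "W = {0}")
    case False
    then obtain \<Psi> where \<Psi>: "\<Psi> \<in> W" "\<Psi> \<noteq> 0"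
      using cvs.subspace_0[OF W] by blast
    obtain F a where F: "finite F" "F \<subseteq> J" "\<Psi> = (\<Sum>j\<in>F. fscale (a j) (?m j))"
      using mode_span_obtain[OF subsetD[OF WV \<Psi>(1)]] by metis
    obtain i where i: "i \<in> F" "a i \<noteq> 0"
    proof (rule ccontr)
      assume "\<not> thesis"
      then have "fscale (a j) (?m j) = 0" if "j \<in> F" for j
        using that \<open>\<And>i. i \<in> F \<Longrightarrow> a i \<noteq> 0 \<Longrightarrow> thesis\<close> by (metis cvs.scale_zero_left)
      then have "\<Psi> = 0"
        unfolding F(3) by (intro sum.neutral ballI)
      with \<Psi>(2) show False ..
    qed
    have "fscale (a i) (?m i) \<in> W"
      using L0_invariant_components[OF F(1) W _ \<Psi>(1)[unfolded F(3)]] inv i(1) unfolding invariant_def by blast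
    then have iW: "?m i \<in> W" and iJ: "i \<in> J"
      using i F(2) scaleD by auto
    \<comment> \<open>Climbing with \<open>Lp\<close> from \<open>i\<close>: convexity keeps the
      intermediate indices in \<open>J\<close>, and the coefficient of each link can be divided
      out.\<close>
    have "j \<in> J \<longrightarrow> ?m j \<in> W" if "i \<le> j" for j
      using that
    proof (induction j rule: int_ge_induct)
      case base
      then show ?case using iW by simp
    next
      case (step j)
      show ?case
      proof
        assume j: "j + 1 \<in> J"
        then have "j \<in> J"
          using convex[OF iJ j] step.hyps by simp
        with step.IH have "Lp (?m j) \<in> W"
          using inv by (simp add: invariant_def)
        moreover have "1 / 2 + freq \<beta>p \<beta>m j \<noteq> 0"
          using unbroken[OF \<open>j \<in> J\<close> j] by linarith
        ultimately show "?m (j + 1) \<in> W"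
          unfolding Lp_mode by (rule scaleD[OF _ coeff])
      qed
    qed
    moreover have "j \<in> J \<longrightarrow> ?m j \<in> W" if "j \<le> i" for j
      using that
    proof (induction j rule: int_le_induct)
      case base
      then show ?case using iW by simp
    next
      case (step j)
      show ?case
      proof
        assume j: "j - 1 \<in> J"
        then have "j \<in> J"
          using convex[OF j iJ] step.hyps by simp
        with step.IH have "Lm (?m j) \<in> W"
          using inv by (simp add: invariant_def)
        moreover have "1 / 2 - freq \<beta>p \<beta>m j \<noteq> 0"
          using unbroken[OF j] \<open>j \<in> J\<close> by (simp add: freq_add)
        ultimately show "?m (j - 1) \<in> W"
          unfolding Lm_mode by (rule scaleD[OF _ coeff])
      qed
    qed
    ultimately have "?m ` J \<subseteq> W"
      by (metis image_subsetI linear)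
    then show ?thesis
      using cvs.span_minimal[OF _ W] WV by blast
  qed simp
qed

section \<open>The spectrum\<close>

text \<open>The phase \<open>\<phi>\<close> makes the problem symmetric: the angles seen at the two
  ends are \<open>p\<close> and \<open>- p\<close>. The boundary conditions then state that the sum
  and the difference of \<open>u * of_real (cos p)\<close> and \<open>v * of_real (sin p)\<close>
  vanish, which decouples \<open>u\<close> from \<open>v\<close>.\<close>

lemma dirac_solution_iff:
  fixes \<beta>p \<beta>m \<omega> :: real
  defines "\<phi> \<equiv> - (\<beta>p - \<beta>m) / 2" and "p \<equiv> \<omega> * pi / 2 + (\<beta>p + \<beta>m) / 2"
  shows "dirac_solution \<beta>p \<beta>m \<omega> \<Phi> \<longleftrightarrow>
    (\<exists>u v. (\<forall>\<rho>\<in>strip. \<Phi> \<rho> = u *s spinor (\<omega> * \<rho> + \<phi>) + v *s spinor (\<omega> * \<rho> + \<phi> - pi / 2)) \<and>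
           u * of_real (cos p) = 0 \<and> v * of_real (sin p) = 0)"
    (is "_ \<longleftrightarrow> (\<exists>u v. ?general u v \<and> _)")
proof -
  have ends: "pi / 2 \<in> strip" "- pi / 2 \<in> strip"
    by (simp_all add: strip_def)
  have bc: "boundary_conditions \<beta>p \<beta>m \<Phi> \<longleftrightarrow> u * of_real (cos p) = 0 \<and> v * of_real (sin p) = 0"
    if gen: "?general u v" for u v
  proof -
    define y where "y = \<omega> * (pi / 2) + \<phi>"
    define z where "z = \<omega> * (- pi / 2) + \<phi>"
    \<comment> \<open>Here \<open>y\<close> and \<open>z\<close> are the spinor angles at the right
      and left end; the boundary parameters shift them to opposite values.\<close>
    have p: "\<beta>p + y = p" "z - \<beta>m = - p"
      by (simp_all add: p_def \<phi>_def y_def z_def field_simps)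
    have e: "\<Phi> (pi / 2) $ 1 = u * of_real (cos y) + v * of_real (sin y)"
      "\<Phi> (pi / 2) $ 2 = - u * of_real (sin y) + v * of_real (cos y)"
      "\<Phi> (- pi / 2) $ 1 = u * of_real (cos z) + v * of_real (sin z)"
      "\<Phi> (- pi / 2) $ 2 = - u * of_real (sin z) + v * of_real (cos z)"
      using bspec[OF gen ends(1)] bspec[OF gen ends(2)] unfolding y_def[symmetric] z_def[symmetric]
      by (simp_all add: cos_diff sin_diff)
    have "of_real (cos \<beta>p) * \<Phi> (pi / 2) $ 1 + of_real (sin \<beta>p) * \<Phi> (pi / 2) $ 2 =
        u * of_real (cos (\<beta>p + y)) + v * of_real (sin (\<beta>p + y))"
      unfolding e cos_add sin_add of_real_add of_real_diff of_real_mult by (simp add: algebra_simps)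
    moreover have "of_real (cos \<beta>m) * \<Phi> (- pi / 2) $ 1 - of_real (sin \<beta>m) * \<Phi> (- pi / 2) $ 2 =
        u * of_real (cos (z - \<beta>m)) + v * of_real (sin (z - \<beta>m))"
      unfolding e cos_diff sin_diff of_real_add of_real_diff of_real_mult by (simp add: algebra_simps)
    moreover have "boundary_conditions \<beta>p \<beta>m \<Phi> \<longleftrightarrow>
        of_real (cos \<beta>p) * \<Phi> (pi / 2) $ 1 + of_real (sin \<beta>p) * \<Phi> (pi / 2) $ 2 = 0 \<and>
        of_real (cos \<beta>m) * \<Phi> (- pi / 2) $ 1 - of_real (sin \<beta>m) * \<Phi> (- pi / 2) $ 2 = 0"
      unfolding boundary_conditions_def by (simp add: eq_neg_iff_add_eq_0)
    ultimately have "boundary_conditions \<beta>p \<beta>m \<Phi> \<longleftrightarrow>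
        u * of_real (cos p) + v * of_real (sin p) = 0 \<and> u * of_real (cos p) - v * of_real (sin p) = 0"
      by (simp only: p cos_minus sin_minus of_real_minus mult_minus_right add_uminus_conv_diff)
    moreover have "a + b = 0 \<and> a - b = 0 \<longleftrightarrow> a = 0 \<and> b = 0" for a b :: complex
      by auto
    ultimately show ?thesis
      by (simp only:)
  qed
  have ode: "\<Phi> differentiable_on strip \<and> (\<forall>\<rho>\<in>strip. dirac \<Phi> \<rho> = \<omega> *\<^sub>R \<Phi> \<rho>)"
    if gen: "?general u v" for u v
  proof -
    have d: "(\<Phi> has_vector_derivative (u * - of_real \<omega>) *s spinor (\<omega> * \<rho> + \<phi> - pi / 2)
        + (v * - of_real \<omega>) *s spinor (\<omega> * \<rho> + (\<phi> - pi / 2) - pi / 2)) (at \<rho> within strip)"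
      if "\<rho> \<in> strip" for \<rho>
      by (rule has_vector_derivative_transform[OF that _ has_vector_derivative_add[OF
            has_vector_derivative_spinor has_vector_derivative_spinor]])
        (use gen in \<open>simp add: add_diff_eq\<close>)
    have "dirac \<Phi> \<rho> = \<omega> *\<^sub>R \<Phi> \<rho>" if \<rho>: "\<rho> \<in> strip" for \<rho>
    proof -
      define x where "x = \<omega> * \<rho> + \<phi>"
      have n: "vector_derivative (\<lambda>r. \<Phi> r $ i) (at \<rho> within strip) =
          ((u * - of_real \<omega>) *s spinor (x - pi / 2) + (v * - of_real \<omega>) *s spinor (x - pi / 2 - pi / 2)) $ i" for i
        using vector_derivative_strip[OF \<rho> bounded_linear.has_vector_derivative[OF bounded_linear_vec_nth d[OF \<rho>]], of i]
        by (simp only: x_def add_diff_eq)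
      show ?thesis
        unfolding dirac_def n bspec[OF gen \<rho>] x_def[symmetric] vec2_eq_iff
        by (simp add: scaleR_conv_of_real[where 'a = complex] cos_diff sin_diff algebra_simps)
    qed
    moreover have "\<Phi> differentiable_on strip"
      using d by (auto simp: differentiable_on_def intro: differentiableI_vector)
    ultimately show ?thesis by blast
  qed
  show ?thesis
  proof
    assume sol: "dirac_solution \<beta>p \<beta>m \<omega> \<Phi>"
    then obtain u v where "?general u v"
      unfolding dirac_solution_def using dirac_solution_general[of \<Phi> \<omega> \<phi>] by metis
    then show "\<exists>u v. ?general u v \<and> u * of_real (cos p) = 0 \<and> v * of_real (sin p) = 0"
      using sol bc unfolding dirac_solution_def by blast
  next
    assume "\<exists>u v. ?general u v \<and> u * of_real (cos p) = 0 \<and> v * of_real (sin p) = 0"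
    then show "dirac_solution \<beta>p \<beta>m \<omega> \<Phi>"
      unfolding dirac_solution_def using ode bc by blast
  qed
qed

text \<open>At an eigenfrequency \<open>p\<close> is \<open>j + 1\<close> quarter turns, so exactly
  one of \<open>cos p\<close> and \<open>sin p\<close> vanishes. For even \<open>j\<close> only
  \<open>u\<close> survives, for odd \<open>j\<close> only \<open>v\<close>, which is the additional
  quarter turn in \<open>mode_phase\<close>.\<close>

lemma dirac_solution_freq_iff:
  "dirac_solution \<beta>p \<beta>m (freq \<beta>p \<beta>m j) \<Phi> \<longleftrightarrow>
     (\<exists>c. \<forall>\<rho>\<in>strip. \<Phi> \<rho> = c *s spinor (freq \<beta>p \<beta>m j * \<rho> + mode_phase \<beta>p \<beta>m j))"
proof -
  have p: "freq \<beta>p \<beta>m j * pi / 2 + (\<beta>p + \<beta>m) / 2 = of_int (j + 1) * (pi / 2)"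
    by (simp add: freq_def field_simps)
  show ?thesis
  proof (cases "even j")
    case True
    then obtain m where "j = 2 * m" by blast
    then have m: "of_int (j + 1) * (pi / 2) = pi * of_int m + pi / 2"
      by (simp add: field_simps)
    have "cos (of_int (j + 1) * (pi / 2)) = 0" "sin (of_int (j + 1) * (pi / 2)) \<noteq> 0"
      unfolding m by (simp_all add: cos_add sin_add cos_npi_int)
    then show ?thesis
      unfolding dirac_solution_iff p using True by simp
  next
    case False
    then obtain m where "j = 2 * m + 1" by (elim oddE)
    then have m: "of_int (j + 1) * (pi / 2) = pi * of_int (m + 1)"
      by (simp add: field_simps)
    have "sin (of_int (j + 1) * (pi / 2)) = 0" "cos (of_int (j + 1) * (pi / 2)) \<noteq> 0"
      unfolding m by (simp_all only: sin_npi_int cos_npi_int) simp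
    then show ?thesis
      unfolding dirac_solution_iff p using False by (simp add: add_diff_eq)
  qed
qed

section \<open>Eigenfrequencies, uniqueness and normalization of the solutions\<close>

lemma spinor_nonzero: "spinor y \<noteq> 0"
proof
  assume "spinor y = 0"
  then have "cos y = 0" "sin y = 0"
    by (simp_all add: vec2_eq_iff)
  then show False
    using sin_cos_squared_add[of y] by simp
qed

lemma nonzero_solution_iff:
  "(\<exists>\<Phi>. dirac_solution \<beta>p \<beta>m \<omega> \<Phi> \<and> (\<exists>\<rho>\<in>strip. \<Phi> \<rho> \<noteq> 0)) \<longleftrightarrow> (\<exists>j. \<omega> = freq \<beta>p \<beta>m j)"
proof
  assume "\<exists>\<Phi>. dirac_solution \<beta>p \<beta>m \<omega> \<Phi> \<and> (\<exists>\<rho>\<in>strip. \<Phi> \<rho> \<noteq> 0)"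
  then obtain \<Phi> \<rho> where \<Phi>: "dirac_solution \<beta>p \<beta>m \<omega> \<Phi>" and \<rho>: "\<rho> \<in> strip" "\<Phi> \<rho> \<noteq> 0"
    by blast
  define p where "p = \<omega> * pi / 2 + (\<beta>p + \<beta>m) / 2"
  define \<phi> where "\<phi> = - (\<beta>p - \<beta>m) / 2"
  obtain u v where gen: "\<forall>\<rho>\<in>strip. \<Phi> \<rho> = u *s spinor (\<omega> * \<rho> + \<phi>) + v *s spinor (\<omega> * \<rho> + \<phi> - pi / 2)"
    and uv: "u * of_real (cos p) = 0" "v * of_real (sin p) = 0"
    using \<Phi> unfolding dirac_solution_iff p_def[symmetric] \<phi>_def[symmetric] by blast
  have "u \<noteq> 0 \<or> v \<noteq> 0"
  proof (rule ccontr)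
    assume "\<not> (u \<noteq> 0 \<or> v \<noteq> 0)"
    with bspec[OF gen \<rho>(1)] \<rho>(2) show False
      by (simp add: vec_eq_iff)
  qed
  with uv have "cos p = 0 \<or> sin p = 0"
    by auto
  then obtain n :: int where n: "p = of_int n * (pi / 2)"
    unfolding cos_zero_iff_int sin_zero_iff_int by blast
  then have "pi * \<omega> + (\<beta>p + \<beta>m) = pi * of_int n"
    by (simp add: p_def field_simps)
  \<comment> \<open>The index is lowered by one because \<open>freq\<close> carries the summand
    \<open>1\<close>.\<close>
  then have "\<omega> = freq \<beta>p \<beta>m (n - 1)"
    by (simp add: freq_def field_simps)
  then show "\<exists>j. \<omega> = freq \<beta>p \<beta>m j" ..
next
  assume "\<exists>j. \<omega> = freq \<beta>p \<beta>m j"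
  then obtain j where \<omega>: "\<omega> = freq \<beta>p \<beta>m j" ..
  have "dirac_solution \<beta>p \<beta>m \<omega> (\<lambda>\<rho>. spinor (\<omega> * \<rho> + mode_phase \<beta>p \<beta>m j))"
    unfolding \<omega> dirac_solution_freq_iff by (rule exI[of _ 1]) simp
  moreover have "0 \<in> strip"
    by (simp add: strip_def)
  ultimately show "\<exists>\<Phi>. dirac_solution \<beta>p \<beta>m \<omega> \<Phi> \<and> (\<exists>\<rho>\<in>strip. \<Phi> \<rho> \<noteq> 0)"
    using spinor_nonzero by blast
qed

lemma dirac_solution_unique:
  assumes "dirac_solution \<beta>p \<beta>m (freq \<beta>p \<beta>m j) \<Phi>" and \<rho>: "\<rho> \<in> strip" "\<Phi> \<rho> \<noteq> 0"
    and "dirac_solution \<beta>p \<beta>m (freq \<beta>p \<beta>m j) \<Phi>'"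
  shows "\<exists>c. \<forall>\<rho>\<in>strip. \<Phi>' \<rho> = c *s \<Phi> \<rho>"
proof -
  obtain c c' where c: "\<forall>\<rho>\<in>strip. \<Phi> \<rho> = c *s spinor (freq \<beta>p \<beta>m j * \<rho> + mode_phase \<beta>p \<beta>m j)"
    and c': "\<forall>\<rho>\<in>strip. \<Phi>' \<rho> = c' *s spinor (freq \<beta>p \<beta>m j * \<rho> + mode_phase \<beta>p \<beta>m j)"
    using assms(1,4) unfolding dirac_solution_freq_iff by blast
  have "c \<noteq> 0"
    using bspec[OF c \<rho>(1)] \<rho>(2) by auto
  then have "\<forall>\<rho>\<in>strip. \<Phi>' \<rho> = (c' / c) *s \<Phi> \<rho>"
    using c c' by (simp add: vector_smult_assoc)
  then show ?thesis ..
qed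

text \<open>A solution at an eigenfrequency is determined up to a complex factor, and the norm fixes
  the modulus of that factor, leaving only a phase.\<close>

lemma normalized_mode_iff:
  "normalized_mode \<beta>p \<beta>m (freq \<beta>p \<beta>m j) \<Psi> \<longleftrightarrow> (\<exists>c. cmod c = 1 \<and> \<Psi> = fscale c (mode \<beta>p \<beta>m j))"
proof -
  have norm: "inner_at t (fscale c (mode \<beta>p \<beta>m j)) (fscale c (mode \<beta>p \<beta>m j)) = of_real ((cmod c)\<^sup>2)" for t c
  proof -
    \<comment> \<open>The summand \<open>0\<close> gives the second argument the shape expected by
      \<open>inner_at_fscale_add_right\<close>.\<close>
    have "inner_at t (fscale c (mode \<beta>p \<beta>m j)) (fscale c (mode \<beta>p \<beta>m j) + 0) =
        c * inner_at t (fscale c (mode \<beta>p \<beta>m j)) (mode \<beta>p \<beta>m j) + inner_at t (fscale c (mode \<beta>p \<beta>m j)) 0"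
      by (rule inner_at_fscale_add_right) (intro fscale_differentiable_fields mode_differentiable_fields zero_differentiable_fields)+
    then show ?thesis
      unfolding inner_at_fscale_mode inner_at_zero by (simp add: complex_norm_square del: of_real_power)
  qed
  have phase: "mode \<beta>p \<beta>m j t \<rho> =
      exp (- \<i> * of_real (freq \<beta>p \<beta>m j * t)) *s (of_real (1 / sqrt pi) *s spinor (freq \<beta>p \<beta>m j * \<rho> + mode_phase \<beta>p \<beta>m j))"
    if "\<rho> \<in> strip" for t \<rho>
    using that unfolding mode_eq_wave wave_def by (simp add: vector_smult_assoc mult.commute)
  have mode_outside: "mode \<beta>p \<beta>m j t \<rho> = 0" if "\<rho> \<notin> strip" for t \<rho>
    using that by (simp add: mode_def)
  show ?thesis
  proof
    assume nm: "normalized_mode \<beta>p \<beta>m (freq \<beta>p \<beta>m j) \<Psi>"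
    then obtain \<Phi> where \<Phi>: "dirac_solution \<beta>p \<beta>m (freq \<beta>p \<beta>m j) \<Phi>"
      and \<Psi>: "\<forall>t. \<forall>\<rho>\<in>strip. \<Psi> t \<rho> = exp (- \<i> * of_real (freq \<beta>p \<beta>m j * t)) *s \<Phi> \<rho>"
      unfolding normalized_mode_def by blast
    obtain c where c: "\<forall>\<rho>\<in>strip. \<Phi> \<rho> = c *s spinor (freq \<beta>p \<beta>m j * \<rho> + mode_phase \<beta>p \<beta>m j)"
      using \<Phi> unfolding dirac_solution_freq_iff by blast
    \<comment> \<open>The factor \<open>sqrt pi\<close> undoes the normalization built into
      \<open>mode\<close>.\<close>
    have eq: "\<Psi> = fscale (c * of_real (sqrt pi)) (mode \<beta>p \<beta>m j)"
    proof (intro ext)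
      fix t \<rho>
      show "\<Psi> t \<rho> = fscale (c * of_real (sqrt pi)) (mode \<beta>p \<beta>m j) t \<rho>"
      proof (cases "\<rho> \<in> strip")
        case True
        then show ?thesis
          unfolding fscale_apply phase[OF True] using \<Psi> c
          by (simp add: vector_smult_assoc mult_ac)
      next
        case False
        moreover have "\<Psi> \<in> spinor_fields"
          using nm by (simp add: normalized_mode_def)
        ultimately show ?thesis
          by (simp add: spinor_fields_def fscale_apply mode_outside)
      qed
    qed
    moreover have "inner_at 0 \<Psi> \<Psi> = 1"
      using nm by (simp add: normalized_mode_def)
    ultimately have "complex_of_real ((cmod (c * of_real (sqrt pi)))\<^sup>2) = 1"
      using norm by simp
    then have "cmod (c * of_real (sqrt pi)) = 1"
      by (metis norm_ge_zero of_real_eq_1_iff power2_eq_1_iff zero_le_one abs_norm_cancel abs_minus_cancel abs_one)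
    with eq show "\<exists>c. cmod c = 1 \<and> \<Psi> = fscale c (mode \<beta>p \<beta>m j)"
      by blast
  next
    assume "\<exists>c. cmod c = 1 \<and> \<Psi> = fscale c (mode \<beta>p \<beta>m j)"
    then obtain c where c: "cmod c = 1" and \<Psi>: "\<Psi> = fscale c (mode \<beta>p \<beta>m j)"
      by blast
    define \<Phi> where "\<Phi> \<rho> = (c * of_real (1 / sqrt pi)) *s spinor (freq \<beta>p \<beta>m j * \<rho> + mode_phase \<beta>p \<beta>m j)" for \<rho>
    have "dirac_solution \<beta>p \<beta>m (freq \<beta>p \<beta>m j) \<Phi>"
      unfolding dirac_solution_freq_iff \<Phi>_def by blast
    moreover have "\<Psi> t \<rho> = exp (- \<i> * of_real (freq \<beta>p \<beta>m j * t)) *s \<Phi> \<rho>" if "\<rho> \<in> strip" for t \<rho>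
      unfolding \<Psi> fscale_apply phase[OF that] \<Phi>_def by (simp add: vector_smult_assoc mult_ac)
    moreover have "\<Psi> \<in> spinor_fields"
      unfolding \<Psi> by (simp add: spinor_fields_def fscale_apply mode_outside)
    moreover have "inner_at t \<Psi> \<Psi> = 1" for t
      unfolding \<Psi> norm c by simp
    ultimately show "normalized_mode \<beta>p \<beta>m (freq \<beta>p \<beta>m j) \<Psi>"
      unfolding normalized_mode_def by blast
  qed
qed

section \<open>Identification of the representations\<close>

text \<open>Without the frequencies \<open>1 / 2\<close> and \<open>- 1 / 2\<close> the ladder over
  all integers is unbroken. The label \<open>\<mu>\<close> is the frequency of some index
  \<open>j0\<close>, and counting indices from \<open>j0\<close> gives the spectrum its standard
  form.\<close>

lemma principal_series_mode_span:
  assumes "\<And>j. freq \<beta>p \<beta>m j \<noteq> 1 / 2 \<and> freq \<beta>p \<beta>m j \<noteq> - 1 / 2"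
  shows "irreducible_rep (cvs.span (range (mode \<beta>p \<beta>m)))"
    and "unitary_rep (cvs.span (range (mode \<beta>p \<beta>m)))"
    and "\<bar>\<mu>\<bar> < 1 / 2 \<Longrightarrow> freq \<beta>p \<beta>m j0 = \<mu> \<Longrightarrow> principal_series \<mu> (cvs.span (range (mode \<beta>p \<beta>m)))"
proof -
  have closed: "ladder_closed \<beta>p \<beta>m UNIV"
    by (simp add: ladder_closed_def)
  show irr: "irreducible_rep (cvs.span (range (mode \<beta>p \<beta>m)))"
    by (rule irreducible_rep_mode_span[OF closed]) (use assms in auto)
  show unit: "unitary_rep (cvs.span (range (mode \<beta>p \<beta>m)))"
    by (rule unitary_rep_mode_span[OF closed])
  show "principal_series \<mu> (cvs.span (range (mode \<beta>p \<beta>m)))"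
    if "\<bar>\<mu>\<bar> < 1 / 2" and \<mu>: "freq \<beta>p \<beta>m j0 = \<mu>"
  proof -
    have shift: "freq \<beta>p \<beta>m = (\<lambda>k. \<mu> + of_int k) \<circ> (\<lambda>j. j - j0)"
      using \<mu> by (simp add: fun_eq_iff freq_def)
    have "surj (\<lambda>j::int. j - j0)"
      by (rule surjI[of _ "\<lambda>k. k + j0"]) simp
    then have "range (freq \<beta>p \<beta>m) = range (\<lambda>k. \<mu> + of_int k)"
      unfolding shift image_comp[symmetric] by simp
    with that(1) irr unit simple_L0_spectrum_mode_span[of \<beta>p \<beta>m UNIV] show ?thesis
      unfolding principal_series_def using casimir_mode_span[OF closed] by simp
  qed
qed

text \<open>The ladder breaks between \<open>- d - 1\<close>, of frequency \<open>- 1 / 2\<close>,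
  and \<open>- d\<close>, of frequency \<open>1 / 2\<close>. The two rays of indices on either side
  are closed and unbroken, and they carry the negative and positive frequencies.\<close>

lemma mock_discrete_series_mode_span:
  assumes half: "\<And>j. freq \<beta>p \<beta>m j = of_int (j + d) + 1 / 2"
  shows "mock_discrete_series 1 (mode_span \<beta>p \<beta>m {j. freq \<beta>p \<beta>m j > 0})"
    and "mock_discrete_series (- 1) (mode_span \<beta>p \<beta>m {j. freq \<beta>p \<beta>m j < 0})"
proof -
  have pos: "{j. freq \<beta>p \<beta>m j > 0} = {- d..}"
  proof (rule set_eqI)
    fix j
    have "of_int (j + d) + 1 / 2 > (0::real) \<longleftrightarrow> j + d \<ge> 0"
      by linarith
    then show "j \<in> {j. freq \<beta>p \<beta>m j > 0} \<longleftrightarrow> j \<in> {- d..}"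
      unfolding half by auto
  qed
  have neg: "{j. freq \<beta>p \<beta>m j < 0} = {.. - d - 1}"
  proof (rule set_eqI)
    fix j
    have "of_int (j + d) + 1 / 2 < (0::real) \<longleftrightarrow> j + d \<le> - 1"
      by linarith
    then show "j \<in> {j. freq \<beta>p \<beta>m j < 0} \<longleftrightarrow> j \<in> {.. - d - 1}"
      unfolding half by auto
  qed
  have half_iff: "freq \<beta>p \<beta>m j = 1 / 2 \<longleftrightarrow> j = - d" "freq \<beta>p \<beta>m j = - 1 / 2 \<longleftrightarrow> j = - d - 1" for j
    unfolding half by linarith+
  have closed: "ladder_closed \<beta>p \<beta>m {- d..}" "ladder_closed \<beta>p \<beta>m {.. - d - 1}"
    unfolding ladder_closed_def half_iff by auto
  have irr: "irreducible_rep (mode_span \<beta>p \<beta>m {- d..})" "irreducible_rep (mode_span \<beta>p \<beta>m {.. - d - 1})"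
    by (rule irreducible_rep_mode_span[OF closed(1)] irreducible_rep_mode_span[OF closed(2)];
        use half_iff(2) in auto)+
  \<comment> \<open>The factor \<open>1\<close> stands for the sign \<open>\<sigma>\<close> of
    \<open>mock_discrete_series\<close>; the natural number belonging to \<open>j\<close> is
    \<open>j + d\<close>.\<close>
  have "freq \<beta>p \<beta>m ` {- d..} = range (\<lambda>n::nat. 1 * (1 / 2 + of_nat n))"
  proof (intro equalityI subsetI)
    fix x assume "x \<in> freq \<beta>p \<beta>m ` {- d..}"
    then obtain j where j: "- d \<le> j" "x = of_int (j + d) + 1 / 2"
      using half by auto
    then have "x = 1 * (1 / 2 + of_nat (nat (j + d)))"
      by simp
    then show "x \<in> range (\<lambda>n::nat. 1 * (1 / 2 + of_nat n))"
      by (rule range_eqI)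
  next
    fix x :: real assume "x \<in> range (\<lambda>n::nat. 1 * (1 / 2 + of_nat n))"
    then obtain n :: nat where "x = 1 * (1 / 2 + of_nat n)"
      by (rule rangeE)
    then have "x = freq \<beta>p \<beta>m (int n - d)"
      unfolding half by simp
    then show "x \<in> freq \<beta>p \<beta>m ` {- d..}"
      by (rule image_eqI) simp
  qed
  with irr(1) unitary_rep_mode_span[OF closed(1)] simple_L0_spectrum_mode_span[of \<beta>p \<beta>m "{- d..}"]
  show "mock_discrete_series 1 (mode_span \<beta>p \<beta>m {j. freq \<beta>p \<beta>m j > 0})"
    unfolding mock_discrete_series_def pos using casimir_mode_span[OF closed(1)] by simp
  have "freq \<beta>p \<beta>m ` {.. - d - 1} = range (\<lambda>n::nat. - 1 * (1 / 2 + of_nat n))"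
  proof (intro equalityI subsetI)
    fix x assume "x \<in> freq \<beta>p \<beta>m ` {.. - d - 1}"
    then obtain j where j: "j \<le> - d - 1" "x = of_int (j + d) + 1 / 2"
      using half by auto
    \<comment> \<open>On the negative ray the counting starts at \<open>- d - 1\<close> and runs
      downwards.\<close>
    then have "x = - 1 * (1 / 2 + of_nat (nat (- d - 1 - j)))"
      by simp
    then show "x \<in> range (\<lambda>n::nat. - 1 * (1 / 2 + of_nat n))"
      by (rule range_eqI)
  next
    fix x :: real assume "x \<in> range (\<lambda>n::nat. - 1 * (1 / 2 + of_nat n))"
    then obtain n :: nat where "x = - 1 * (1 / 2 + of_nat n)"
      by (rule rangeE)
    then have "x = freq \<beta>p \<beta>m (- d - 1 - int n)"
      unfolding half by simp
    then show "x \<in> freq \<beta>p \<beta>m ` {.. - d - 1}"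
      by (rule image_eqI) simp
  qed
  with irr(2) unitary_rep_mode_span[OF closed(2)] simple_L0_spectrum_mode_span[of \<beta>p \<beta>m "{.. - d - 1}"]
  show "mock_discrete_series (- 1) (mode_span \<beta>p \<beta>m {j. freq \<beta>p \<beta>m j < 0})"
    unfolding mock_discrete_series_def neg using casimir_mode_span[OF closed(2)] by simp
qed

lemma mock_discrete_series_invariant: "mock_discrete_series \<sigma> V \<Longrightarrow> invariant V"
  by (simp add: mock_discrete_series_def irreducible_rep_def representation_def)

section \<open>Chiral rotation of the modes\<close>

lemma chiral_rotation_wave:
  "(\<lambda>t \<rho>. chiral_rotation \<theta> *v wave \<omega> \<phi> t \<rho>) = wave \<omega> (\<phi> + \<theta>)"
proof (intro ext)
  fix t \<rho>
  have rot: "chiral_rotation \<theta> *v (c *s spinor y) = c *s spinor (y + \<theta>)" for c y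
    by (simp add: vec2_eq_iff chiral_rotation_def matrix_vector_mult_def sum_2 cos_add sin_add algebra_simps)
  show "chiral_rotation \<theta> *v wave \<omega> \<phi> t \<rho> = wave \<omega> (\<phi> + \<theta>) t \<rho>"
    unfolding wave_def using rot by (cases "\<rho> \<in> strip") (simp_all only: if_True if_False add.assoc matrix_vector_mult_0_right)
qed

text \<open>The shift \<open>d\<close> of the index compensates the change of
  \<open>\<beta>p + \<beta>m\<close> in the frequency, and the rotation angle matches the phases up
  to a multiple of \<pi>. For \<open>d = 0\<close> they agree exactly. For \<open>d = 1\<close> the
  parity of the index changes: the phases still agree for even \<open>k\<close>, but differ by \<pi>
  for odd \<open>k\<close>, where the sign is \<open>- 1\<close>.\<close>

lemma mode_chiral_rotation:
  assumes "\<beta>p + \<beta>m = pi / 2 \<and> d = 0 \<or> \<beta>p + \<beta>m = 3 * pi / 2 \<and> d = 1"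
  shows "\<exists>s\<in>{1, - 1}. mode \<beta>p \<beta>m (k + d) =
    fscale s (\<lambda>t \<rho>. chiral_rotation (pi / 2 - \<beta>p) *v mode (pi / 2) 0 k t \<rho>)"
proof -
  define \<phi> where "\<phi> = mode_phase (pi / 2) 0 k + (pi / 2 - \<beta>p)"
  define \<omega> where "\<omega> = freq (pi / 2) 0 k"
  have R: "(\<lambda>t \<rho>. chiral_rotation (pi / 2 - \<beta>p) *v mode (pi / 2) 0 k t \<rho>) = wave \<omega> \<phi>"
    unfolding mode_eq_wave chiral_rotation_wave \<phi>_def \<omega>_def ..
  have \<omega>: "freq \<beta>p \<beta>m (k + d) = \<omega>"
    using assms by (auto simp: freq_def \<omega>_def)
  have "mode_phase \<beta>p \<beta>m (k + d) = \<phi> \<or> \<phi> = mode_phase \<beta>p \<beta>m (k + d) - pi"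
    using assms by (auto simp: \<phi>_def field_simps)
  then have "mode \<beta>p \<beta>m (k + d) = fscale 1 (wave \<omega> \<phi>) \<or> mode \<beta>p \<beta>m (k + d) = fscale (- 1) (wave \<omega> \<phi>)"
  proof
    assume "mode_phase \<beta>p \<beta>m (k + d) = \<phi>"
    then show ?thesis
      unfolding mode_eq_wave \<omega> by simp
  next
    assume \<phi>: "\<phi> = mode_phase \<beta>p \<beta>m (k + d) - pi"
    show ?thesis
      unfolding mode_eq_wave \<omega> \<phi> wave_minus_pi by simp
  qed
  then show ?thesis
    unfolding R by blast
qed

section \<open>Spectrum and ladder, principal series, mock-discrete series and chiral rotation
  combined\<close>

theorem mainTheorem6:
  fixes \<beta>p \<beta>m \<beta> :: real
  assumes "\<beta>p \<in> {0..<pi}" and "\<beta>m \<in> {0..<pi}"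
    and "\<beta> = (\<beta>p + \<beta>m) / pi"
  shows
    "\<comment> \<open>(a)\<close>
     (\<forall>\<omega>::real. (\<exists>\<Phi>. dirac_solution \<beta>p \<beta>m \<omega> \<Phi> \<and> (\<exists>\<rho>\<in>strip. \<Phi> \<rho> \<noteq> 0)) \<longleftrightarrow>
         (\<exists>j::int. \<omega> = of_int j + 1 - \<beta>)) \<and>
     (\<forall>j \<Phi> \<Phi>'. dirac_solution \<beta>p \<beta>m (freq \<beta>p \<beta>m j) \<Phi> \<and> (\<exists>\<rho>\<in>strip. \<Phi> \<rho> \<noteq> 0) \<and>
         dirac_solution \<beta>p \<beta>m (freq \<beta>p \<beta>m j) \<Phi>' \<longrightarrow>
         (\<exists>c. \<forall>\<rho>\<in>strip. \<Phi>' \<rho> = c *s \<Phi> \<rho>)) \<and>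
     (\<forall>j \<Psi>. normalized_mode \<beta>p \<beta>m (freq \<beta>p \<beta>m j) \<Psi> \<longleftrightarrow>
         (\<exists>c. cmod c = 1 \<and> \<Psi> = fscale c (mode \<beta>p \<beta>m j))) \<and>
     (\<forall>j. Lp (mode \<beta>p \<beta>m j) =
            fscale (\<i> * (- 1) powi (j + 1) * of_real (1 / 2 + freq \<beta>p \<beta>m j)) (mode \<beta>p \<beta>m (j + 1)) \<and>
          Lm (mode \<beta>p \<beta>m j) =
            fscale (\<i> * (- 1) powi (j + 1) * of_real (1 / 2 - freq \<beta>p \<beta>m j)) (mode \<beta>p \<beta>m (j - 1))) \<and>
     \<comment> \<open>(b)\<close>
     (\<beta> \<noteq> 1 / 2 \<and> \<beta> \<noteq> 3 / 2 \<longrightarrow>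
        (let V = cvs.span (range (mode \<beta>p \<beta>m)) in
         irreducible_rep V \<and> unitary_rep V \<and>
         (0 \<le> \<beta> \<and> \<beta> < 1 / 2 \<longrightarrow> principal_series (- \<beta>) V) \<and>
         (1 / 2 < \<beta> \<and> \<beta> < 3 / 2 \<longrightarrow> principal_series (1 - \<beta>) V) \<and>
         (3 / 2 < \<beta> \<and> \<beta> < 2 \<longrightarrow> principal_series (2 - \<beta>) V))) \<and>
     \<comment> \<open>(c)\<close>
     (\<beta> = 1 / 2 \<or> \<beta> = 3 / 2 \<longrightarrow>
        (let Vpos = cvs.span (mode \<beta>p \<beta>m ` {j. freq \<beta>p \<beta>m j > 0});
             Vneg = cvs.span (mode \<beta>p \<beta>m ` {j. freq \<beta>p \<beta>m j < 0}) in
         invariant Vpos \<and> invariant Vneg \<and>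
         mock_discrete_series 1 Vpos \<and> mock_discrete_series (- 1) Vneg) \<and>
        (\<forall>n::int. \<exists>j k. freq \<beta>p \<beta>m j = 1 / 2 + of_int n \<and> freq (pi / 2) 0 k = 1 / 2 + of_int n \<and>
           (\<exists>s\<in>{1, - 1}. mode \<beta>p \<beta>m j =
              fscale s (\<lambda>t \<rho>. chiral_rotation (pi / 2 - \<beta>p) *v mode (pi / 2) 0 k t \<rho>))))"
proof -
  have freq: "freq \<beta>p \<beta>m j = of_int j + 1 - \<beta>" for j
    using assms(3) by (simp add: freq_def)
  have sum: "\<beta>p + \<beta>m = \<beta> * pi"
    using assms(3) by simp
  have range: "0 \<le> \<beta>" "\<beta> < 2"
  proof -
    have "0 \<le> \<beta> * pi" "\<beta> * pi < 2 * pi"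
      using assms(1,2) unfolding sum[symmetric] by auto
    then show "0 \<le> \<beta>" "\<beta> < 2"
      using pi_gt_zero by (auto simp: zero_le_mult_iff)
  qed
  have a1: "(\<exists>\<Phi>. dirac_solution \<beta>p \<beta>m \<omega> \<Phi> \<and> (\<exists>\<rho>\<in>strip. \<Phi> \<rho> \<noteq> 0)) \<longleftrightarrow>
      (\<exists>j::int. \<omega> = of_int j + 1 - \<beta>)" for \<omega>
    unfolding nonzero_solution_iff freq ..
  have a2: "dirac_solution \<beta>p \<beta>m (freq \<beta>p \<beta>m j) \<Phi> \<and> (\<exists>\<rho>\<in>strip. \<Phi> \<rho> \<noteq> 0) \<and>
      dirac_solution \<beta>p \<beta>m (freq \<beta>p \<beta>m j) \<Phi>' \<longrightarrow> (\<exists>c. \<forall>\<rho>\<in>strip. \<Phi>' \<rho> = c *s \<Phi> \<rho>)" for j \<Phi> \<Phi>'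
    using dirac_solution_unique by blast
  have b: "let V = cvs.span (range (mode \<beta>p \<beta>m)) in
      irreducible_rep V \<and> unitary_rep V \<and>
      (0 \<le> \<beta> \<and> \<beta> < 1 / 2 \<longrightarrow> principal_series (- \<beta>) V) \<and>
      (1 / 2 < \<beta> \<and> \<beta> < 3 / 2 \<longrightarrow> principal_series (1 - \<beta>) V) \<and>
      (3 / 2 < \<beta> \<and> \<beta> < 2 \<longrightarrow> principal_series (2 - \<beta>) V)"
    if ne: "\<beta> \<noteq> 1 / 2 \<and> \<beta> \<noteq> 3 / 2"
  proof -
    have not_half: "freq \<beta>p \<beta>m j \<noteq> 1 / 2 \<and> freq \<beta>p \<beta>m j \<noteq> - 1 / 2" for j
    proof -
      \<comment> \<open>In the range \<open>0 \<le> \<beta>\<close>, \<open>\<beta> < 2\<close> the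
        only half-integers are the two excluded values.\<close>
      have "\<beta> \<noteq> of_int n + 1 / 2" for n
      proof
        assume "\<beta> = of_int n + 1 / 2"
        moreover from this range have "n = 0 \<or> n = 1"
          by linarith
        ultimately show False
          using ne by auto
      qed
      from this[of j] this[of "j + 1"] show ?thesis
        unfolding freq by auto
    qed
    note ps = principal_series_mode_span[OF not_half]
    \<comment> \<open>In each of the three ranges of \<open>\<beta>\<close>, one of the indices
      \<open>- 1\<close>, \<open>0\<close>, \<open>1\<close> has its frequency strictly between
      \<open>- 1 / 2\<close> and \<open>1 / 2\<close>; this frequency is the label of the
      series.\<close>
    have w: "freq \<beta>p \<beta>m (- 1) = - \<beta>" "freq \<beta>p \<beta>m 0 = 1 - \<beta>" "freq \<beta>p \<beta>m 1 = 2 - \<beta>"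
      unfolding freq by simp_all
    have "principal_series (- \<beta>) (cvs.span (range (mode \<beta>p \<beta>m)))" if "0 \<le> \<beta> \<and> \<beta> < 1 / 2"
      using that by (intro ps(3)[OF _ w(1)]) linarith
    moreover have "principal_series (1 - \<beta>) (cvs.span (range (mode \<beta>p \<beta>m)))" if "1 / 2 < \<beta> \<and> \<beta> < 3 / 2"
      using that by (intro ps(3)[OF _ w(2)]) linarith
    moreover have "principal_series (2 - \<beta>) (cvs.span (range (mode \<beta>p \<beta>m)))" if "3 / 2 < \<beta> \<and> \<beta> < 2"
      using that by (intro ps(3)[OF _ w(3)]) linarith
    ultimately show ?thesis
      unfolding Let_def using ps(1,2) by blast
  qed
  have c: "(let Vpos = cvs.span (mode \<beta>p \<beta>m ` {j. freq \<beta>p \<beta>m j > 0});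
             Vneg = cvs.span (mode \<beta>p \<beta>m ` {j. freq \<beta>p \<beta>m j < 0}) in
         invariant Vpos \<and> invariant Vneg \<and>
         mock_discrete_series 1 Vpos \<and> mock_discrete_series (- 1) Vneg) \<and>
        (\<forall>n::int. \<exists>j k. freq \<beta>p \<beta>m j = 1 / 2 + of_int n \<and> freq (pi / 2) 0 k = 1 / 2 + of_int n \<and>
           (\<exists>s\<in>{1, - 1}. mode \<beta>p \<beta>m j =
              fscale s (\<lambda>t \<rho>. chiral_rotation (pi / 2 - \<beta>p) *v mode (pi / 2) 0 k t \<rho>)))"
    if half: "\<beta> = 1 / 2 \<or> \<beta> = 3 / 2"
  proof -
    \<comment> \<open>The integer part of \<open>\<beta>\<close>. It enters the mock-discrete series
      with a minus sign, because the frequencies decrease with \<open>\<beta>\<close>.\<close>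
    define d :: int where "d = (if \<beta> = 1 / 2 then 0 else 1)"
    have d: "\<beta> = of_int d + 1 / 2"
      using half by (auto simp: d_def)
    have "freq \<beta>p \<beta>m j = of_int (j + - d) + 1 / 2" for j
      unfolding freq d by simp
    note md = mock_discrete_series_mode_span[OF this]
    have "\<beta>p + \<beta>m = pi / 2 \<and> d = 0 \<or> \<beta>p + \<beta>m = 3 * pi / 2 \<and> d = 1"
      using half unfolding sum d_def by auto
    note rot = mode_chiral_rotation[OF this]
    \<comment> \<open>The witnesses for frequency \<open>1 / 2 + of_int n\<close> are
      \<open>n + d\<close> for the given parameters and \<open>n\<close> for the reference
      parameters.\<close>
    have "freq \<beta>p \<beta>m (n + d) = 1 / 2 + of_int n" "freq (pi / 2) 0 n = 1 / 2 + of_int n" for n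
      unfolding freq d by (simp_all add: freq_def)
    with rot md mock_discrete_series_invariant[OF md(1)] mock_discrete_series_invariant[OF md(2)]
    show ?thesis
      unfolding Let_def by blast
  qed
  show ?thesis
    by (intro conjI allI a1 a2 normalized_mode_iff Lp_mode Lm_mode impI[OF b] impI[OF c]) simp_all
qed

end
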